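(* Let $V_1$ be a finite-dimensional subspace of a separable infinite-dimensional complex Hilbert space $\mathcal{H}$, let $N=\dim(V_1)$, and let $(e_n)_{n=2}^\infty$ be an orthonormal basis of $V_1^\perp$. For each $m\in\mathbb{N}$ let $V_m=V_1+\mathrm{span}\{e_n:2\leq n\leq m\}$ and let $P_m:\mathcal{H}\to V_m$ be the orthogonal projection. Let $0<A\leq B\leq1$ and $C>0$, and suppose that $(\psi_j)_{j\in I}$ is a frame of $V_1$ with lower frame bound $A$, upper frame bound $B$, and such that $$\inf_{|\alpha|=1}\|x-\alpha y\|^2\leq C\sum_{j\in I}\big||\langle x,\psi_j\rangle|-|\langle y,\psi_j\rangle|\big|^2\qquad\text{for all } x,y\in V_1.$$ Let $(\varphi_j)_{j\in J}\subseteq V_1$, with $J$ a finite index set, be a frame of $V_1$ with frame bounds $0<A\leq B\leq1$. Let $c,\kappa>0$ and $0<\varepsilon<\min(8^{-1},A)$ be constants and let $(\alpha_n)_{n=1}^\infty$, $(\beta_n)_{n=1}^\infty$ be real sequences such that: (i) for all $x,y\in V_1$, $$|J|\leq\kappa\,\big|\big\{j\in J:\ c^{-1}\|x\|\geq\sqrt{N}|\langle x,\varphi_j\rangle|\geq c\|x\|\ \text{ and }\ c^{-1}\|y\|\geq\sqrt{N}|\langle y,\varphi_j\rangle|\geq c\|y\|\big\}\big|;$$ (ii) $\displaystyle\sum_{n\geq2}\alpha_n^2\leq\varepsilon^2\,11^{-1}|J|^{-1}c^{-2}\min\left(C^{-1},\kappa^{-1}64^{-1}c^2\right)$; (iii)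 $\beta_n<2^{-6}c^2N^{-1/2}\alpha_n$ for all $n\geq2$. Define $$\mathcal{B}=\{f\in\mathcal{H}:\ \|f-P_mf\|\leq\beta_{m+1}\|f\|\ \text{ for every } m\in\mathbb{N}\}.$$ Let $\Phi:=(\psi_j)_{j\in I}\cup(\varphi_{j,n,1})_{j\in J,\,n\geq2}\cup(\varphi_{j,n,i})_{j\in J,\,n\geq2}$ be the frame of $\mathcal{H}$ where, for $j\in J$ and $n\geq2$, $$\varphi_{j,n,1}:=\alpha_n\varphi_j+(2|J|)^{-1/2}e_n\quad\text{and}\quad\varphi_{j,n,i}:=\alpha_n\varphi_j-(2|J|)^{-1/2}\,i\,e_n$$ (with $i$ the imaginary unit). Then for all $f,g\in\mathcal{B}$ we have $$\inf_{|\alpha|=1}\|f-\alpha g\|^2\leq(1-\varepsilon)^{-1}\max\left(C,64\kappa c^{-2}\right)\|\mathcal{A}_\Phi(f)-\mathcal{A}_\Phi(g)\|^2.$$ Furthermore, $\Phi$ has lower frame bound $\left(1-\sqrt{\varepsilon/A}\right)^2A$ and upper frame bound $(1+\sqrt{\varepsilon})^2$.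
   Context: A family $(\phi_k)_{k\in I}$ in a Hilbert space $H$ is a frame of $H$ with lower frame bound $A>0$ and upper frame bound $B$ if $A\|f\|^2\leq\sum_{k\in I}|\langle f,\phi_k\rangle|^2\leq B\|f\|^2$ for all $f\in H$. (Bounds are not required to be optimal.) For a frame $\Phi=(\phi_k)_{k\in I}$, $\mathcal{A}_\Phi(f)=(|\langle f,\phi_k\rangle|)_{k\in I}\in\ell_2(I)$, and $\|\mathcal{A}_\Phi(f)-\mathcal{A}_\Phi(g)\|$ is the $\ell_2(I)$ norm. The infimum $\inf_{|\alpha|=1}$ is over complex scalars of modulus one. For a finite set $S$, $|S|$ denotes its cardinality. *)

theory Defs
  imports "HOL-Analysis.Analysis"
begin

text \<open>
  Complex Hilbert spaces. The distribution only has real inner product spaces; the classes below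
  add a complex scalar multiplication extending the real one, and a complex inner product that is
  linear in its first argument and induces the norm.
\<close>

class complex_vector = real_vector +
  fixes scaleC :: "complex \<Rightarrow> 'a \<Rightarrow> 'a"
  assumes scaleC_add_right: "scaleC a (x + y) = scaleC a x + scaleC a y"
    and scaleC_add_left: "scaleC (a + b) x = scaleC a x + scaleC b x"
    and scaleC_scaleC: "scaleC a (scaleC b x) = scaleC (a * b) x"
    and scaleC_one: "scaleC 1 x = x"
    and scaleR_scaleC: "scaleR r x = scaleC (complex_of_real r) x"

class complex_inner = complex_vector + real_normed_vector +
  fixes cinner :: "'a \<Rightarrow> 'a \<Rightarrow> complex"
  assumes cinner_commute: "cinner x y = cnj (cinner y x)"
    and cinner_add_left: "cinner (x + y) z = cinner x z + cinner y z"
    and cinner_scaleC_left: "cinner (scaleC a x) y = a * cinner x y"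
    and cinner_self: "cinner x x = complex_of_real ((norm x)\<^sup>2)"

class chilbert_space = complex_inner + complete_space

instantiation complex :: chilbert_space
begin

definition scaleC_complex :: "complex \<Rightarrow> complex \<Rightarrow> complex" where
  "scaleC_complex a x = a * x"

definition cinner_complex :: "complex \<Rightarrow> complex \<Rightarrow> complex" where
  "cinner_complex x y = x * cnj y"

instance
proof
  fix x :: complex
  show "cinner x x = complex_of_real ((norm x)\<^sup>2)"
    by (simp only: cinner_complex_def complex_norm_square)
qed (auto simp: scaleC_complex_def cinner_complex_def algebra_simps scaleR_conv_of_real)

end

global_interpretation complex_vector:
  vector_space "scaleC :: complex \<Rightarrow> 'a \<Rightarrow> 'a::complex_vector"
  defines csubspace = complex_vector.subspace
    and cspan = complex_vector.span
    and cdim = complex_vector.dim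
  by unfold_locales (auto simp: scaleC_add_right scaleC_add_left scaleC_scaleC scaleC_one)

definition cfinite_dim :: "'a::complex_vector set \<Rightarrow> bool" where
  "cfinite_dim V \<longleftrightarrow> (\<exists>S. finite S \<and> cspan S = V)"

definition orth_compl :: "'a::complex_inner set \<Rightarrow> 'a set" where
  "orth_compl V = {x. \<forall>v\<in>V. cinner x v = 0}"

text \<open>Meaningful when \<open>V\<close> is a closed subspace of a Hilbert space (e.g. finite-dimensional).\<close>

definition orth_proj :: "'a::complex_inner set \<Rightarrow> 'a \<Rightarrow> 'a" where
  "orth_proj V f = (THE p. p \<in> V \<and> f - p \<in> orth_compl V)"

definition is_onb :: "'a::complex_inner set \<Rightarrow> 'i set \<Rightarrow> ('i \<Rightarrow> 'a) \<Rightarrow> bool" where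
  "is_onb W I e \<longleftrightarrow>
     (\<forall>m\<in>I. \<forall>n\<in>I. cinner (e m) (e n) = (if m = n then 1 else 0)) \<and>
     closure (cspan (e ` I)) = W"

text \<open>
  \<open>is_frame V A B I \<phi>\<close>: the family \<open>(\<phi> k)\<close>, \<open>k \<in> I\<close>, is a frame of \<open>V\<close> with (not necessarily
  optimal) lower bound \<open>A > 0\<close> and upper bound \<open>B\<close>. Convergence is required explicitly, because
  \<open>infsum\<close> is 0 on families that are not summable.
\<close>

definition is_frame ::
  "'a::complex_inner set \<Rightarrow> real \<Rightarrow> real \<Rightarrow> 'i set \<Rightarrow> ('i \<Rightarrow> 'a) \<Rightarrow> bool" where
  "is_frame V A B I \<phi> \<longleftrightarrow> 0 < A \<and> (\<forall>k\<in>I. \<phi> k \<in> V) \<and>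
     (\<forall>f\<in>V. (\<lambda>k. (cmod (cinner f (\<phi> k)))\<^sup>2) summable_on I \<and>
        A * (norm f)\<^sup>2 \<le> (\<Sum>\<^sub>\<infinity>k\<in>I. (cmod (cinner f (\<phi> k)))\<^sup>2) \<and>
        (\<Sum>\<^sub>\<infinity>k\<in>I. (cmod (cinner f (\<phi> k)))\<^sup>2) \<le> B * (norm f)\<^sup>2)"

definition frame_magnitudes :: "('i \<Rightarrow> 'a::complex_inner) \<Rightarrow> 'a \<Rightarrow> 'i \<Rightarrow> real" where
  "frame_magnitudes \<phi> f = (\<lambda>k. cmod (cinner f (\<phi> k)))"

definition ell2_norm :: "'i set \<Rightarrow> ('i \<Rightarrow> real) \<Rightarrow> real" where
  "ell2_norm I a = sqrt (\<Sum>\<^sub>\<infinity>k\<in>I. (a k)\<^sup>2)"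

definition Vsp :: "'a::complex_inner set \<Rightarrow> (nat \<Rightarrow> 'a) \<Rightarrow> nat \<Rightarrow> 'a set" where
  "Vsp V1 e m = {x + y |x y. x \<in> V1 \<and> y \<in> cspan (e ` {2..m})}"

definition Bset ::
  "'a::complex_inner set \<Rightarrow> (nat \<Rightarrow> 'a) \<Rightarrow> (nat \<Rightarrow> real) \<Rightarrow> 'a set" where
  "Bset V1 e \<beta> =
     {f. \<forall>m\<ge>1. norm (f - orth_proj (Vsp V1 e m) f) \<le> \<beta> (m + 1) * norm f}"

text \<open>
  The frame \<open>\<Phi>\<close>. The union of the three families is indexed by a disjoint sum: \<open>Inl j\<close> is the
  index of \<open>\<psi> j\<close>, while \<open>Inr (Inl (j, n))\<close> and \<open>Inr (Inr (j, n))\<close> are the indices \<open>(j, n, 1)\<close>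
  and \<open>(j, n, \<i>)\<close>.
\<close>

definition Phi_index :: "'i set \<Rightarrow> 'j set \<Rightarrow> ('i + 'j \<times> nat + 'j \<times> nat) set" where
  "Phi_index I J = I <+> ((J \<times> {2..}) <+> (J \<times> {2..}))"

definition Phi ::
  "'j set \<Rightarrow> (nat \<Rightarrow> 'a::complex_inner) \<Rightarrow> (nat \<Rightarrow> real) \<Rightarrow> ('i \<Rightarrow> 'a) \<Rightarrow> ('j \<Rightarrow> 'a) \<Rightarrow>
    'i + 'j \<times> nat + 'j \<times> nat \<Rightarrow> 'a" where
  "Phi J e \<alpha> \<psi> \<phi> k = (case k of
      Inl j \<Rightarrow> \<psi> j
    | Inr (Inl (j, n)) \<Rightarrow> \<alpha> n *\<^sub>R \<phi> j + (1 / sqrt (2 * real (card J))) *\<^sub>R e n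
    | Inr (Inr (j, n)) \<Rightarrow> \<alpha> n *\<^sub>R \<phi> j - (1 / sqrt (2 * real (card J))) *\<^sub>R scaleC \<i> (e n))"

end

theory Submission
  imports Defs
begin

text \<open>
  Write \<open>P\<close> for the orthogonal projection onto \<open>V1\<close>. The coefficients of \<open>f\<close> against the vectors
  indexed by \<open>(j, n, 1)\<close> and \<open>(j, n, \<i>)\<close> are \<open>a + u\<close> and \<open>a + \<i> * u\<close>, where \<open>a\<close> is
  \<open>\<alpha> n\<close> times the coefficient of \<open>P f\<close> against \<open>\<phi> j\<close>, and \<open>u\<close> is a scaled coefficient of \<open>f\<close>
  against \<open>e n\<close>. Pythagoras and Young's inequality give the frame bounds.

  For stability, choose the phase of \<open>g\<close> that aligns \<open>P g\<close> best with \<open>P f\<close>, where the norm of \<open>P g\<close> is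
  at most that of \<open>P f\<close>. The hypothesis on \<open>\<psi>\<close> bounds the distance of the projections. Membership in
  the approximation set makes \<open>u\<close> small compared with \<open>a\<close> whenever \<open>j\<close> is one of the good indices of
  \<open>P f\<close>, so that the magnitudes for the two phases \<open>1\<close> and \<open>\<i>\<close> determine \<open>u\<close> stably up to the error
  of replacing the \<open>a\<close> of \<open>g\<close> by that of \<open>f\<close>. Averaging over the good indices and summing over \<open>n\<close>
  bounds the remaining coefficients; the errors sum to at most \<open>\<epsilon>\<close> times the squared distance of the
  projections, because the \<open>\<alpha> n\<close> are square summable with a small sum.
\<close>

section \<open>Complex inner products\<close>

lemma cinner_add_right:
  fixes x y z :: "'a::complex_inner"
  shows "cinner x (y + z) = cinner x y + cinner x z"
  by (subst (1 2 3) cinner_commute) (simp add: cinner_add_left)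

lemma cinner_scaleC_right:
  fixes x y :: "'a::complex_inner"
  shows "cinner x (scaleC a y) = cnj a * cinner x y"
  by (subst (1 2) cinner_commute) (simp add: cinner_scaleC_left)

lemma cinner_zero_left [simp]:
  fixes y :: "'a::complex_inner"
  shows "cinner 0 y = 0"
  using cinner_add_left[of 0 0 y] by simp

lemma cinner_zero_right [simp]:
  fixes x :: "'a::complex_inner"
  shows "cinner x 0 = 0"
  using cinner_add_right[of x 0 0] by simp

lemma cinner_minus_left:
  fixes x y :: "'a::complex_inner"
  shows "cinner (- x) y = - cinner x y"
  by (rule minus_unique[symmetric]) (simp flip: cinner_add_left)

lemma cinner_minus_right:
  fixes x y :: "'a::complex_inner"
  shows "cinner x (- y) = - cinner x y"
  by (rule minus_unique[symmetric]) (simp flip: cinner_add_right)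

lemma cinner_diff_left:
  fixes x y z :: "'a::complex_inner"
  shows "cinner (x - y) z = cinner x z - cinner y z"
  using cinner_add_left[of x "- y" z] by (simp add: cinner_minus_left)

lemma cinner_diff_right:
  fixes x y z :: "'a::complex_inner"
  shows "cinner x (y - z) = cinner x y - cinner x z"
  using cinner_add_right[of x y "- z"] by (simp add: cinner_minus_right)

lemma cinner_scaleR_right:
  fixes x y :: "'a::complex_inner"
  shows "cinner x (r *\<^sub>R y) = of_real r * cinner x y"
  by (simp add: scaleR_scaleC cinner_scaleC_right)

lemma cinner_sum_left:
  fixes y :: "'a::complex_inner"
  shows "cinner (\<Sum>i\<in>F. h i) y = (\<Sum>i\<in>F. cinner (h i) y)"
  by (induction F rule: infinite_finite_induct) (auto simp: cinner_add_left)

lemma cinner_sym_zero: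
  fixes x y :: "'a::complex_inner"
  shows "cinner x y = 0 \<Longrightarrow> cinner y x = 0"
  by (subst cinner_commute) simp

lemma power2_norm_eq_Re_cinner:
  fixes x :: "'a::complex_inner"
  shows "(norm x)\<^sup>2 = Re (cinner x x)"
  by (simp add: cinner_self)

lemma norm_add_power2:
  fixes x y :: "'a::complex_inner"
  shows "(norm (x + y))\<^sup>2 = (norm x)\<^sup>2 + (norm y)\<^sup>2 + 2 * Re (cinner x y)"
proof -
  have "Re (cinner y x) = Re (cinner x y)"
    by (subst cinner_commute) simp
  then show ?thesis
    by (simp add: power2_norm_eq_Re_cinner cinner_add_left cinner_add_right)
qed

lemma norm_diff_power2:
  fixes x y :: "'a::complex_inner"
  shows "(norm (x - y))\<^sup>2 = (norm x)\<^sup>2 + (norm y)\<^sup>2 - 2 * Re (cinner x y)"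
  using norm_add_power2[of x "- y"] by (simp add: cinner_minus_right)

lemma pythagoras:
  fixes x y :: "'a::complex_inner"
  shows "cinner x y = 0 \<Longrightarrow> (norm (x + y))\<^sup>2 = (norm x)\<^sup>2 + (norm y)\<^sup>2"
  by (simp add: norm_add_power2)

lemma norm_scaleC:
  fixes x :: "'a::complex_inner"
  shows "norm (scaleC a x) = cmod a * norm x"
proof -
  have "cinner (scaleC a x) (scaleC a x) = of_real ((cmod a * norm x)\<^sup>2)"
    unfolding cinner_scaleC_left cinner_scaleC_right cinner_self[of x]
    by (simp only: complex_norm_square power_mult_distrib of_real_mult mult_ac)
  then have "(norm (scaleC a x))\<^sup>2 = (cmod a * norm x)\<^sup>2"
    by (simp only: power2_norm_eq_Re_cinner Re_complex_of_real)
  then show ?thesis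
    by simp
qed

lemma cmod_cinner_unit_le:
  fixes x e :: "'a::complex_inner"
  assumes "cinner e e = 1"
  shows "cmod (cinner x e) \<le> norm x"
proof -
  have "cinner (x - scaleC (cinner x e) e) (scaleC (cinner x e) e) = 0"
    by (simp add: cinner_diff_left cinner_scaleC_left cinner_scaleC_right assms)
  from pythagoras[OF this] have "(norm (scaleC (cinner x e) e))\<^sup>2 \<le> (norm x)\<^sup>2"
    by simp
  moreover have "norm e = 1"
    using assms power2_norm_eq_Re_cinner[of e] by (simp add: power2_eq_1_iff)
       (use norm_ge_zero[of e] in linarith)
  ultimately show ?thesis
    by (simp add: norm_scaleC)
qed

section \<open>Orthogonal projections and Parseval's identity\<close>

lemma cinner_zero_cspan:
  fixes x :: "'a::complex_inner"
  assumes "v \<in> cspan S" and "\<And>s. s \<in> S \<Longrightarrow> cinner x s = 0"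
  shows "cinner x v = 0"
  using assms(1)
  by (induction rule: complex_vector.span_induct_alt)
    (auto simp: cinner_add_right cinner_scaleC_right assms(2))

text \<open>One Gram-Schmidt step per generator: the new generator \<open>a\<close> contributes only
  its part \<open>w\<close> orthogonal to the earlier span, and the old projection is corrected
  along \<open>w\<close>.\<close>

lemma ex_orth_proj:
  fixes f :: "'a::complex_inner"
  assumes "finite S"
  shows "\<exists>p\<in>cspan S. f - p \<in> orth_compl (cspan S)"
  using assms
proof (induction S arbitrary: f)
  case empty
  then show ?case
    by (auto simp: orth_compl_def)
next
  case (insert a S)
  obtain p where p: "p \<in> cspan S" "f - p \<in> orth_compl (cspan S)"
    using insert.IH by blast
  obtain b where b: "b \<in> cspan S" "a - b \<in> orth_compl (cspan S)"
    using insert.IH by blast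
  define w where "w = a - b"
  define k where "k = cinner f w / cinner w w"
  define q where "q = p + scaleC k w"
  have w_orth: "cinner w v = 0" "cinner v w = 0" if "v \<in> cspan S" for v
    using b that cinner_sym_zero by (auto simp: orth_compl_def w_def)
  have S: "cspan S \<subseteq> cspan (insert a S)"
    by (intro complex_vector.span_mono) auto
  have a: "a \<in> cspan (insert a S)"
    by (intro complex_vector.span_base) auto
  have "q \<in> cspan (insert a S)"
    unfolding q_def w_def
    using S a p b by (blast intro: complex_vector.span_add complex_vector.span_scale
        complex_vector.span_diff)
  moreover have "cinner (f - q) w = 0"
  proof (cases "w = 0")
    case False
    then have "cinner w w \<noteq> 0"
      by (simp add: cinner_self)
    then show ?thesis
      using p by (simp add: q_def k_def cinner_diff_left cinner_add_left cinner_scaleC_left w_orth)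
  qed simp
  moreover have q_orth: "cinner (f - q) v = 0" if "v \<in> cspan S" for v
    using p that
    by (simp add: q_def orth_compl_def cinner_diff_left cinner_add_left cinner_scaleC_left w_orth)
  ultimately have "cinner (f - q) a = 0"
    using b by (simp add: w_def cinner_diff_right)
  then have "cinner (f - q) v = 0" if "v \<in> cspan (insert a S)" for v
    using that by (rule_tac cinner_zero_cspan)
      (auto intro: q_orth complex_vector.span_base)
  then show ?case
    using \<open>q \<in> cspan (insert a S)\<close> by (auto simp: orth_compl_def)
qed

text \<open>Two candidates differ by a vector of \<open>V\<close> that is orthogonal to
  \<open>V\<close>, hence to itself.\<close>

lemma orth_proj_eqI:
  fixes f :: "'a::complex_inner"
  assumes "csubspace V" "p \<in> V" "f - p \<in> orth_compl V"
  shows "orth_proj V f = p"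
  unfolding orth_proj_def
proof (rule the_equality)
  fix q assume q: "q \<in> V \<and> f - q \<in> orth_compl V"
  then have "q - p \<in> V"
    using assms by (intro complex_vector.subspace_diff) auto
  then have "cinner (f - p) (q - p) - cinner (f - q) (q - p) = 0"
    using q assms by (simp add: orth_compl_def)
  then have "cinner (q - p) (q - p) = 0"
    by (simp add: cinner_diff_left)
  then show "q = p"
    by (simp add: cinner_self)
qed (use assms in auto)

lemma orth_proj_cfinite_dim:
  fixes f :: "'a::complex_inner"
  assumes "cfinite_dim V"
  shows "orth_proj V f \<in> V" "f - orth_proj V f \<in> orth_compl V"
proof -
  obtain S where S: "finite S" "V = cspan S"
    using assms by (auto simp: cfinite_dim_def)
  obtain p where p: "p \<in> V" "f - p \<in> orth_compl V"
    using ex_orth_proj[OF S(1)] S(2) by blast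
  moreover have "csubspace V"
    unfolding S by (rule complex_vector.subspace_span)
  ultimately have "orth_proj V f = p"
    by (intro orth_proj_eqI)
  with p show "orth_proj V f \<in> V" "f - orth_proj V f \<in> orth_compl V"
    by simp_all
qed

text \<open>The partial expansion \<open>P F\<close> is the best approximation of \<open>u\<close>
  in the span of the \<open>e n\<close> with \<open>n\<close> in \<open>F\<close>. Finite
  combinations are dense in \<open>W\<close>, so the error tends to 0 along the finite sets.\<close>

lemma parseval:
  fixes u :: "'a::complex_inner"
  assumes onb: "is_onb W I e" and u: "u \<in> W"
  shows "((\<lambda>n. (cmod (cinner u (e n)))\<^sup>2) has_sum (norm u)\<^sup>2) I"
  unfolding has_sum_def
proof (rule tendstoI)
  fix \<delta> :: real assume "0 < \<delta>"
  define P where "P F = (\<Sum>n\<in>F. scaleC (cinner u (e n)) (e n))" for F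
  have orthonormal: "cinner (e m) (e n) = (if m = n then 1 else 0)" if "m \<in> I" "n \<in> I" for m n
    using onb that by (auto simp: is_onb_def)
  have coeff: "cinner (P F) (e n) = cinner u (e n)" if "finite F" "F \<subseteq> I" "n \<in> F" for F n
  proof -
    have "cinner (P F) (e n) = (\<Sum>m\<in>F. cinner u (e m) * (if m = n then 1 else 0))"
      unfolding P_def cinner_sum_left cinner_scaleC_left
      using that by (intro sum.cong refl) (simp add: orthonormal subset_iff)
    also have "\<dots> = (\<Sum>m\<in>F. if m = n then cinner u (e m) else 0)"
      by (intro sum.cong) auto
    also have "\<dots> = cinner u (e n)"
      using that by (simp add: sum.delta)
    finally show ?thesis .
  qed
  have P_span: "P F \<in> cspan (e ` F)" for F
    unfolding P_def
    by (intro complex_vector.span_sum complex_vector.span_scale complex_vector.span_base) auto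
  have orth: "cinner (u - P F) v = 0" if "finite F" "F \<subseteq> I" "v \<in> cspan (e ` F)" for F v
    using that by (rule_tac cinner_zero_cspan[of v "e ` F"]) (auto simp: cinner_diff_left coeff)
  have best: "(norm (u - w))\<^sup>2 = (norm (u - P F))\<^sup>2 + (norm (P F - w))\<^sup>2"
    if "finite F" "F \<subseteq> I" "w \<in> cspan (e ` F)" for F w
  proof -
    have "cinner (u - P F) (P F - w) = 0"
      using that P_span by (intro orth complex_vector.span_diff)
    from pythagoras[OF this] show ?thesis
      by simp
  qed
  have norm_P: "(norm (P F))\<^sup>2 = (\<Sum>n\<in>F. (cmod (cinner u (e n)))\<^sup>2)"
    if "finite F" "F \<subseteq> I" for F
  proof -
    have "cinner (P F) (P F) = (\<Sum>n\<in>F. cinner u (e n) * cinner (e n) (P F))"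
      by (subst (1) P_def) (simp add: cinner_sum_left cinner_scaleC_left)
    also have "\<dots> = (\<Sum>n\<in>F. cinner u (e n) * cnj (cinner u (e n)))"
    proof (intro sum.cong refl arg_cong2[where f = "(*)"])
      fix n assume "n \<in> F"
      then show "cinner (e n) (P F) = cnj (cinner u (e n))"
        using that by (subst cinner_commute) (simp add: coeff)
    qed
    finally show ?thesis
      by (simp only: power2_norm_eq_Re_cinner Re_sum complex_norm_square[symmetric]
          Re_complex_of_real)
  qed
  have "u \<in> closure (cspan (e ` I))"
    using onb u by (simp add: is_onb_def)
  moreover have "0 < sqrt \<delta>"
    using \<open>0 < \<delta>\<close> by simp
  ultimately obtain w where w: "w \<in> cspan (e ` I)" "dist w u < sqrt \<delta>"
    unfolding closure_approachable by blast
  obtain T r where T: "finite T" "T \<subseteq> e ` I" "w = (\<Sum>a\<in>T. scaleC (r a) a)"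
    using w(1) unfolding complex_vector.span_explicit by blast
  obtain F0 where F0: "F0 \<subseteq> I" "finite F0" "T = e ` F0"
    using finite_subset_image[OF T(1,2)] by blast
  have w_span: "w \<in> cspan (e ` F0)"
    unfolding T(3) F0(3)[symmetric]
    by (intro complex_vector.span_sum complex_vector.span_scale complex_vector.span_base)
  have "dist (\<Sum>n\<in>F. (cmod (cinner u (e n)))\<^sup>2) ((norm u)\<^sup>2) < \<delta>"
    if F: "finite F" "F0 \<subseteq> F" "F \<subseteq> I" for F
  proof -
    have "w \<in> cspan (e ` F)"
      using w_span complex_vector.span_mono[of "e ` F0" "e ` F"] F by blast
    then have "(norm (u - P F))\<^sup>2 \<le> (norm (u - w))\<^sup>2"
      using best F by simp
    also have "\<dots> < (sqrt \<delta>)\<^sup>2"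
      using w(2) by (intro power_strict_mono) (auto simp: dist_norm norm_minus_commute)
    finally have "(norm (u - P F))\<^sup>2 < \<delta>"
      using \<open>0 < \<delta>\<close> by simp
    \<comment> \<open>Taking \<open>w = 0\<close> in \<open>best\<close> shows that the squared
      error is exactly the gap between the squared norms.\<close>
    moreover have "(norm u)\<^sup>2 = (norm (u - P F))\<^sup>2 + (norm (P F))\<^sup>2"
      using best[of F 0] F by (simp add: complex_vector.span_zero)
    ultimately show ?thesis
      using F by (simp add: dist_real_def norm_P)
  qed
  then show "\<forall>\<^sub>F F in finite_subsets_at_top I.
      dist (\<Sum>n\<in>F. (cmod (cinner u (e n)))\<^sup>2) ((norm u)\<^sup>2) < \<delta>"
    unfolding eventually_finite_subsets_at_top using F0 by blast
qed

section \<open>Sums over disjoint unions and products\<close>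

lemma has_sum_Plus:
  fixes h :: "'i + 'j \<Rightarrow> 'b::topological_comm_monoid_add"
  assumes "((\<lambda>i. h (Inl i)) has_sum a) X" "((\<lambda>j. h (Inr j)) has_sum b) Y"
  shows "(h has_sum (a + b)) (X <+> Y)"
  unfolding Plus_def
proof (rule has_sum_Un_disjoint)
  show "(h has_sum a) (Inl ` X)" "(h has_sum b) (Inr ` Y)"
    using assms by (simp_all add: has_sum_reindex o_def)
qed auto

lemma infsum_Plus:
  fixes h :: "'i + 'j \<Rightarrow> real"
  assumes "h summable_on (X <+> Y)"
  shows "(\<lambda>i. h (Inl i)) summable_on X" "(\<lambda>j. h (Inr j)) summable_on Y"
    "infsum h (X <+> Y) = (\<Sum>\<^sub>\<infinity>i\<in>X. h (Inl i)) + (\<Sum>\<^sub>\<infinity>j\<in>Y. h (Inr j))"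
proof -
  have "h summable_on (Inl ` X)" "h summable_on (Inr ` Y)"
    by (auto intro: summable_on_subset_banach[OF assms])
  then show *: "(\<lambda>i. h (Inl i)) summable_on X" "(\<lambda>j. h (Inr j)) summable_on Y"
    by (simp_all add: summable_on_reindex o_def)
  show "infsum h (X <+> Y) = (\<Sum>\<^sub>\<infinity>i\<in>X. h (Inl i)) + (\<Sum>\<^sub>\<infinity>j\<in>Y. h (Inr j))"
    by (intro infsumI has_sum_Plus has_sum_infsum *)
qed

lemma has_sum_finite_Times:
  fixes h :: "'j \<times> 'n \<Rightarrow> 'b::topological_comm_monoid_add"
  assumes "finite J" "\<And>j. j \<in> J \<Longrightarrow> ((\<lambda>n. h (j, n)) has_sum S j) Y"
  shows "(h has_sum (\<Sum>j\<in>J. S j)) (J \<times> Y)"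
proof -
  have "(h has_sum S j) (Pair j ` Y)" if "j \<in> J" for j
    using assms(2)[OF that] by (simp add: has_sum_reindex inj_on_def o_def)
  then have "(h has_sum sum S J) (\<Union>j\<in>J. Pair j ` Y)"
    using assms(1) by (intro sum_has_sum) auto
  moreover have "(\<Union>j\<in>J. Pair j ` Y) = J \<times> Y"
    by auto
  ultimately show ?thesis
    by simp
qed

lemma has_sum_sum:
  fixes h :: "'j \<Rightarrow> 'n \<Rightarrow> 'b::topological_comm_monoid_add"
  assumes "\<And>j. j \<in> J \<Longrightarrow> (h j has_sum S j) Y"
  shows "((\<lambda>n. \<Sum>j\<in>J. h j n) has_sum (\<Sum>j\<in>J. S j)) Y"
  using assms by (induction J rule: infinite_finite_induct) (auto intro: has_sum_add)

lemma infsum_finite_Times: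
  fixes h :: "'j \<times> 'n \<Rightarrow> real"
  assumes "finite J" "h summable_on (J \<times> Y)"
  shows "(\<lambda>n. \<Sum>j\<in>J. h (j, n)) summable_on Y"
    "infsum h (J \<times> Y) = (\<Sum>\<^sub>\<infinity>n\<in>Y. \<Sum>j\<in>J. h (j, n))"
proof -
  have "(\<lambda>n. h (j, n)) summable_on Y" if "j \<in> J" for j
  proof -
    have "h summable_on (Pair j ` Y)"
      using that by (intro summable_on_subset_banach[OF assms(2)]) auto
    then show ?thesis
      by (simp add: summable_on_reindex inj_on_def o_def)
  qed
  then have *: "((\<lambda>n. h (j, n)) has_sum (\<Sum>\<^sub>\<infinity>n\<in>Y. h (j, n))) Y" if "j \<in> J" for j
    using that by (intro has_sum_infsum)
  have "((\<lambda>n. \<Sum>j\<in>J. h (j, n)) has_sum (\<Sum>j\<in>J. \<Sum>\<^sub>\<infinity>n\<in>Y. h (j, n))) Y"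
    by (intro has_sum_sum * )
  then show "(\<lambda>n. \<Sum>j\<in>J. h (j, n)) summable_on Y"
    "infsum h (J \<times> Y) = (\<Sum>\<^sub>\<infinity>n\<in>Y. \<Sum>j\<in>J. h (j, n))"
    using infsumI[OF has_sum_finite_Times[OF assms(1) * ]]
    by (auto simp: infsumI dest: has_sum_imp_summable)
qed

section \<open>Magnitudes of complex numbers\<close>

text \<open>The cross term is absorbed by expanding the nonnegative square
  \<open>(t * cmod a - cmod b)\<^sup>2 / t\<close>; the weight \<open>t\<close> is later tuned to
  the size of the perturbation.\<close>

lemma young_upper:
  fixes a b :: complex
  assumes "0 < t"
  shows "(cmod (a + b))\<^sup>2 \<le> (1 + t) * (cmod a)\<^sup>2 + (1 + 1 / t) * (cmod b)\<^sup>2"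
proof -
  have "(cmod (a + b))\<^sup>2 \<le> (cmod a + cmod b)\<^sup>2"
    by (intro power_mono norm_triangle_ineq) auto
  moreover have "(t * cmod a - cmod b)\<^sup>2 / t
      = t * (cmod a)\<^sup>2 - 2 * (cmod a * cmod b) + (cmod b)\<^sup>2 / t"
    using assms by (simp add: field_simps power2_eq_square)
  moreover have "0 \<le> (t * cmod a - cmod b)\<^sup>2 / t"
    using assms by simp
  ultimately show ?thesis
    by (simp add: power2_sum power2_diff algebra_simps)
qed

text \<open>The reverse triangle inequality leaves \<open>(cmod a - cmod b)\<^sup>2\<close>, whose
  cross term is absorbed by the same weighted square.\<close>

lemma young_lower:
  fixes a b :: complex
  assumes "0 < t"
  shows "(1 - t) * (cmod a)\<^sup>2 - (1 / t - 1) * (cmod b)\<^sup>2 \<le> (cmod (a + b))\<^sup>2"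
proof -
  have "(cmod a - cmod b)\<^sup>2 \<le> (cmod (a + b))\<^sup>2"
    using norm_triangle_ineq3[of a "- b"] by (simp add: abs_le_square_iff[symmetric])
  moreover have "(t * cmod a - cmod b)\<^sup>2 / t
      = t * (cmod a)\<^sup>2 - 2 * (cmod a * cmod b) + (cmod b)\<^sup>2 / t"
    using assms by (simp add: field_simps power2_eq_square)
  moreover have "0 \<le> (t * cmod a - cmod b)\<^sup>2 / t"
    using assms by simp
  ultimately show ?thesis
    by (simp add: power2_sum power2_diff algebra_simps)
qed

text \<open>Expanding the squared magnitudes of \<open>a + u\<close> and \<open>a + v\<close>
  isolates the term linear in \<open>u - v\<close>, and both differences of squares factor. As
  \<open>u\<close> and \<open>v\<close> are small, the sum factors are at most
  \<open>5 / 2 * cmod a\<close> (generously) and \<open>cmod a / 16\<close>.\<close>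

lemma cmod_diff_square_le:
  fixes a u v :: complex
  assumes "cmod u \<le> cmod a / 32" "cmod v \<le> cmod a / 32"
  shows "(2 * Re ((u - v) * cnj a))\<^sup>2
    \<le> 2 * (5 / 2 * cmod a)\<^sup>2 * (cmod (a + u) - cmod (a + v))\<^sup>2
      + 2 * (cmod a / 16 * cmod (u - v))\<^sup>2"
proof -
  define X where "X = cmod (a + u)"
  define Y where "Y = cmod (a + v)"
  have "X\<^sup>2 - Y\<^sup>2 = 2 * Re ((u - v) * cnj a) + ((cmod u)\<^sup>2 - (cmod v)\<^sup>2)"
    unfolding X_def Y_def cmod_power2 by (simp add: algebra_simps power2_eq_square)
  moreover have "X\<^sup>2 - Y\<^sup>2 = (X + Y) * (X - Y)"
    "(cmod u)\<^sup>2 - (cmod v)\<^sup>2 = (cmod u + cmod v) * (cmod u - cmod v)"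
    by (simp_all add: algebra_simps power2_eq_square)
  ultimately have eq: "2 * Re ((u - v) * cnj a)
      = (X + Y) * (X - Y) - (cmod u + cmod v) * (cmod u - cmod v)"
    by simp
  have "\<bar>(X + Y) * (X - Y)\<bar> \<le> \<bar>5 / 2 * cmod a * (X - Y)\<bar>"
  proof -
    have "X + Y \<le> 5 / 2 * cmod a" "0 \<le> X + Y"
      unfolding X_def Y_def
      using norm_triangle_ineq[of a u] norm_triangle_ineq[of a v] norm_ge_zero[of a] assms
      by (linarith, simp)
    then show ?thesis
      unfolding abs_mult[of _ "X - Y"] by (intro mult_right_mono) auto
  qed
  then have 1: "((X + Y) * (X - Y))\<^sup>2 \<le> (5 / 2 * cmod a * (X - Y))\<^sup>2"
    by (simp only: abs_le_square_iff)
  have "\<bar>(cmod u + cmod v) * (cmod u - cmod v)\<bar> \<le> \<bar>cmod a / 16 * cmod (u - v)\<bar>"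
    unfolding abs_mult
    using assms norm_triangle_ineq3[of u v] by (intro mult_mono) auto
  then have 2: "((cmod u + cmod v) * (cmod u - cmod v))\<^sup>2 \<le> (cmod a / 16 * cmod (u - v))\<^sup>2"
    by (simp only: abs_le_square_iff)
  have "(p - q)\<^sup>2 \<le> 2 * p\<^sup>2 + 2 * q\<^sup>2" for p q :: real
    using zero_le_power2[of "p + q"] by (simp add: power2_eq_square algebra_simps)
  from this[of "(X + Y) * (X - Y)" "(cmod u + cmod v) * (cmod u - cmod v)"] 1 2
  show ?thesis
    unfolding eq X_def[symmetric] Y_def[symmetric] power_mult_distrib by linarith
qed

text \<open>The two phases \<open>1\<close> and \<open>\<i>\<close> read off the real and imaginary part of \<open>(u - v) * cnj a\<close>, up to
  second-order terms.\<close>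

lemma cmod_diff_le_two_phases:
  fixes a u v :: complex
  assumes uv: "cmod u \<le> cmod a / 32" "cmod v \<le> cmod a / 32"
  shows "(cmod (u - v))\<^sup>2 \<le> 4 * ((cmod (a + u) - cmod (a + v))\<^sup>2
    + (cmod (a + \<i> * u) - cmod (a + \<i> * v))\<^sup>2)"
proof (cases "a = 0")
  case True
  with uv show ?thesis by simp
next
  case False
  define P where "P = (cmod (a + u) - cmod (a + v))\<^sup>2 + (cmod (a + \<i> * u) - cmod (a + \<i> * v))\<^sup>2"
  have "(2 * Re ((\<i> * u - \<i> * v) * cnj a))\<^sup>2
    \<le> 2 * (5 / 2 * cmod a)\<^sup>2 * (cmod (a + \<i> * u) - cmod (a + \<i> * v))\<^sup>2
      + 2 * (cmod a / 16 * cmod (\<i> * u - \<i> * v))\<^sup>2"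
    using uv by (intro cmod_diff_square_le) (simp_all add: norm_mult)
  moreover have "cmod (\<i> * u - \<i> * v) = cmod (u - v)"
    by (simp add: norm_mult flip: right_diff_distrib)
  \<comment> \<open>Multiplying by \<open>\<i>\<close> exchanges real and imaginary part up to sign,
    so the two phases together see the whole modulus.\<close>
  moreover have "(2 * Re ((\<i> * u - \<i> * v) * cnj a))\<^sup>2 = (2 * Im ((u - v) * cnj a))\<^sup>2"
    by (simp add: power2_eq_square algebra_simps)
  moreover note cmod_diff_square_le[OF uv]
  ultimately have "(2 * Re ((u - v) * cnj a))\<^sup>2 + (2 * Im ((u - v) * cnj a))\<^sup>2
     \<le> 2 * (5 / 2 * cmod a)\<^sup>2 * P + 4 * (cmod a / 16 * cmod (u - v))\<^sup>2"
    unfolding P_def by (simp add: distrib_left)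
  moreover have "(2 * Re ((u - v) * cnj a))\<^sup>2 + (2 * Im ((u - v) * cnj a))\<^sup>2
      = 4 * (cmod (u - v) * cmod a)\<^sup>2"
    using cmod_power2[of "(u - v) * cnj a"]
    by (simp only: norm_mult power_mult_distrib complex_mod_cnj) simp
  ultimately have "4 * (cmod (u - v) * cmod a)\<^sup>2
      \<le> 2 * (5 / 2 * cmod a)\<^sup>2 * P + 4 * (cmod a / 16 * cmod (u - v))\<^sup>2"
    by linarith
  \<comment> \<open>The second-order term takes \<open>4 / 256\<close> off the factor 4, leaving
    \<open>255 / 64\<close>; the quotient of \<open>25 / 2\<close> by this is below 4.\<close>
  then have "(cmod a)\<^sup>2 * (255 / 64 * (cmod (u - v))\<^sup>2) \<le> (cmod a)\<^sup>2 * (25 / 2 * P)"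
    by (simp add: power_mult_distrib power_divide algebra_simps)
  then have "255 / 64 * (cmod (u - v))\<^sup>2 \<le> 25 / 2 * P"
    using False by simp
  moreover have "0 \<le> P"
    by (simp add: P_def)
  ultimately show ?thesis
    unfolding P_def[symmetric] by linarith
qed

text \<open>Only \<open>Re (cnj a * cinner x y)\<close> depends on \<open>a\<close> in the expanded
  squared norm, and it is largest when \<open>a\<close> carries the phase of
  \<open>cinner x y\<close>. The infimum over phases is thus attained at a concrete phase.\<close>

lemma ex_optimal_phase:
  fixes x y :: "'a::complex_inner"
  obtains \<theta> where "cmod \<theta> = 1"
    "\<And>a. cmod a = 1 \<Longrightarrow> (norm (x - scaleC \<theta> y))\<^sup>2 \<le> (norm (x - scaleC a y))\<^sup>2"
proof -
  define z where "z = cinner x y"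
  define \<theta> where "\<theta> = (if z = 0 then 1 else sgn z)"
  have \<theta>: "cmod \<theta> = 1" "cnj \<theta> * z = of_real (cmod z)"
  proof -
    show "cmod \<theta> = 1" by (simp add: \<theta>_def norm_sgn)
    show "cnj \<theta> * z = of_real (cmod z)"
    proof (cases "z = 0")
      case False
      have "cnj z * z = of_real (cmod z) * of_real (cmod z)"
        using complex_norm_square[of z] by (simp add: power2_eq_square mult.commute)
      with False show ?thesis
        by (simp add: \<theta>_def sgn_eq field_simps)
    qed (simp add: \<theta>_def)
  qed
  show thesis
  proof (rule that[OF \<theta>(1)])
    fix a :: complex assume a: "cmod a = 1"
    have "Re (cnj a * z) \<le> cmod (cnj a * z)"
      by (rule complex_Re_le_cmod)
    then show "(norm (x - scaleC \<theta> y))\<^sup>2 \<le> (norm (x - scaleC a y))\<^sup>2"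
      using \<theta> a
      by (simp add: norm_diff_power2 cinner_scaleC_right norm_scaleC z_def[symmetric] norm_mult)
  qed
qed

section \<open>The perturbed frame\<close>

locale onb_splitting =
  fixes V1 :: "'a::complex_inner set" and e :: "nat \<Rightarrow> 'a"
  assumes subspace: "csubspace V1" and fin_dim: "cfinite_dim V1"
    and onb: "is_onb (orth_compl V1) {2..} e"
begin

section \<open>Projection onto \<open>V1\<close> and expansion of the orthogonal part\<close>

abbreviation P :: "'a \<Rightarrow> 'a" where
  "P \<equiv> orth_proj V1"

lemma P_in: "P f \<in> V1"
  by (rule orth_proj_cfinite_dim[OF fin_dim])

lemma P_orth: "f - P f \<in> orth_compl V1"
  by (rule orth_proj_cfinite_dim[OF fin_dim])

lemma cinner_P: "v \<in> V1 \<Longrightarrow> cinner f v = cinner (P f) v"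
  using P_orth[of f] unfolding orth_compl_def by (auto simp: cinner_diff_left)

lemma P_diff_scaleC: "P (f - scaleC a g) = P f - scaleC a (P g)"
proof (rule orth_proj_eqI[OF subspace])
  show "P f - scaleC a (P g) \<in> V1"
    by (intro complex_vector.subspace_diff complex_vector.subspace_scale subspace P_in)
  show "f - scaleC a g - (P f - scaleC a (P g)) \<in> orth_compl V1"
    by (auto simp: orth_compl_def cinner_diff_left cinner_scaleC_left cinner_P[of _ f] cinner_P[of _ g])
qed

lemma e_orthonormal: "m \<ge> 2 \<Longrightarrow> n \<ge> 2 \<Longrightarrow> cinner (e m) (e n) = (if m = n then 1 else 0)"
  using onb by (simp add: is_onb_def)

lemma e_orth_V1:
  assumes "n \<ge> 2" "v \<in> V1"
  shows "cinner v (e n) = 0"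
proof -
  have "e n \<in> closure (cspan (e ` {2..}))"
    using assms by (intro subsetD[OF closure_subset] complex_vector.span_base) auto
  then have "cinner (e n) v = 0"
    using onb assms(2) by (simp add: is_onb_def orth_compl_def)
  then show ?thesis
    by (rule cinner_sym_zero)
qed

lemma norm_P_split: "(norm f)\<^sup>2 = (norm (P f))\<^sup>2 + (norm (f - P f))\<^sup>2"
proof -
  have "cinner (f - P f) (P f) = 0"
    using P_orth P_in by (simp add: orth_compl_def)
  from pythagoras[OF this] show ?thesis
    by simp
qed

text \<open>Parseval's identity for \<open>f - P f\<close>, whose coefficients are those of
  \<open>f\<close> because every \<open>e n\<close> is orthogonal to \<open>V1\<close>.\<close>

lemma coeff_has_sum:
  "((\<lambda>n. (cmod (cinner f (e n)))\<^sup>2) has_sum (norm (f - P f))\<^sup>2) {2..}"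
proof -
  have "cinner (f - P f) (e n) = cinner f (e n)" if "n \<in> {2..}" for n
    using that by (simp add: cinner_diff_left e_orth_V1 P_in)
  then have "((\<lambda>n. (cmod (cinner f (e n)))\<^sup>2) has_sum (norm (f - P f))\<^sup>2) {2..}
      \<longleftrightarrow> ((\<lambda>n. (cmod (cinner (f - P f) (e n)))\<^sup>2) has_sum (norm (f - P f))\<^sup>2) {2..}"
    by (intro has_sum_cong) simp
  with parseval[OF onb P_orth[of f]] show ?thesis
    by blast
qed

section \<open>Decay of coefficients in the approximation set\<close>

lemma cfinite_dim_Vsp: "cfinite_dim (Vsp V1 e m)"
proof -
  obtain S where S: "finite S" "cspan S = V1"
    using fin_dim by (auto simp: cfinite_dim_def)
  have "cspan (S \<union> e ` {2..m}) = Vsp V1 e m"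
    using S by (auto simp: complex_vector.span_Un Vsp_def)
  moreover have "finite (S \<union> e ` {2..m})"
    using S(1) by simp
  ultimately show ?thesis
    unfolding cfinite_dim_def by (intro exI conjI)
qed

lemma Vsp_1: "Vsp V1 e 1 = V1"
  by (simp add: Vsp_def)

text \<open>The instance \<open>m = 1\<close> of membership: the range \<open>{2..1}\<close> is
  empty, so \<open>Vsp V1 e 1\<close> is \<open>V1\<close>, and the bound carries the index
  \<open>m + 1 = 2\<close>.\<close>

lemma Bset_norm_diff:
  assumes "f \<in> Bset V1 e \<beta>"
  shows "norm (f - P f) \<le> \<beta> 2 * norm f"
proof -
  have "\<forall>m\<ge>1. norm (f - orth_proj (Vsp V1 e m) f) \<le> \<beta> (m + 1) * norm f"
    using assms by (simp add: Bset_def)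
  from this[rule_format, of 1] show ?thesis
    by (simp add: Vsp_1 one_add_one del: One_nat_def add_Suc_right)
qed

text \<open>Membership is used at \<open>m = n - 1\<close>: \<open>e n\<close> is orthogonal to that
  space, so the coefficient sees only the remainder of \<open>f\<close>, and the bound carries the
  index \<open>m + 1 = n\<close>.\<close>

lemma Bset_coeff:
  assumes "f \<in> Bset V1 e \<beta>" "n \<ge> 2"
  shows "cmod (cinner f (e n)) \<le> \<beta> n * norm f"
proof -
  define q where "q = orth_proj (Vsp V1 e (n - 1)) f"
  have "q \<in> Vsp V1 e (n - 1)"
    unfolding q_def by (rule orth_proj_cfinite_dim[OF cfinite_dim_Vsp])
  then obtain x y where q: "q = x + y" "x \<in> V1" "y \<in> cspan (e ` {2..n - 1})"
    unfolding Vsp_def by blast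
  have "cinner (e n) y = 0"
    using q(3) assms(2) by (rule_tac cinner_zero_cspan) (auto simp: e_orthonormal)
  then have "cinner y (e n) = 0"
    by (rule cinner_sym_zero)
  then have "cinner q (e n) = 0"
    using q(1,2) assms(2) by (simp add: cinner_add_left e_orth_V1)
  then have "cmod (cinner f (e n)) = cmod (cinner (f - q) (e n))"
    by (simp add: cinner_diff_left)
  also have "\<dots> \<le> norm (f - q)"
    using assms(2) by (intro cmod_cinner_unit_le) (simp add: e_orthonormal)
  also have "\<dots> \<le> \<beta> (n - 1 + 1) * norm f"
  proof -
    have "1 \<le> n - 1"
      using assms(2) by simp
    then show ?thesis
      using assms(1) unfolding q_def Bset_def by blast
  qed
  finally show ?thesis
    using assms(2) by simp
qed

text \<open>The part of \<open>f\<close> orthogonal to \<open>V1\<close> has at most half the norm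
  of \<open>f\<close> and can be absorbed. Bounds by \<open>norm f\<close> thereby become bounds by
  \<open>norm (P f)\<close>, and \<open>f\<close> vanishes with \<open>P f\<close>.\<close>

lemma Bset_norm_le:
  assumes "f \<in> Bset V1 e \<beta>" "\<beta> 2 \<le> 1 / 2"
  shows "norm f \<le> 2 * norm (P f)"
proof -
  have "norm f \<le> norm (P f) + norm (f - P f)"
    using norm_triangle_ineq[of "P f" "f - P f"] by simp
  also have "norm (f - P f) \<le> 1 / 2 * norm f"
    using Bset_norm_diff[OF assms(1)] mult_right_mono[OF assms(2), of "norm f"] by simp
  finally show ?thesis
    by simp
qed

section \<open>Coefficients against the perturbed frame and its frame bounds\<close>

lemma cinner_Phi:
  "cinner f (Phi J e \<alpha> \<psi> \<phi> (Inl i)) = cinner f (\<psi> i)"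
  "\<phi> j \<in> V1 \<Longrightarrow> cinner f (Phi J e \<alpha> \<psi> \<phi> (Inr (Inl (j, n))))
    = \<alpha> n * cinner (P f) (\<phi> j) + (1 / sqrt (2 * real (card J))) * cinner f (e n)"
  "\<phi> j \<in> V1 \<Longrightarrow> cinner f (Phi J e \<alpha> \<psi> \<phi> (Inr (Inr (j, n))))
    = \<alpha> n * cinner (P f) (\<phi> j) + \<i> * ((1 / sqrt (2 * real (card J))) * cinner f (e n))"
  \<comment> \<open>Conjugation in the second argument turns the factor \<open>- \<i>\<close> of
    \<open>e n\<close> into \<open>+ \<i>\<close>.\<close>
  by (simp_all add: Phi_def cinner_add_right cinner_diff_right cinner_scaleR_right
      cinner_scaleC_right cinner_P[of "\<phi> j" f] del: of_real_divide of_real_mult)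

text \<open>\<open>\<Phi>\<close> is a perturbation of the frame consisting of the \<open>\<psi> i\<close> and \<open>2 card J\<close> scaled copies of
  each \<open>e n\<close>; the values \<open>t = sqrt \<epsilon>\<close> and \<open>t = sqrt (\<epsilon> / A)\<close> in Young's inequality make the
  resulting bounds complete squares.\<close>

lemma is_frame_Phi:
  assumes psi: "is_frame V1 A B I \<psi>" and AB: "A \<le> B" "B \<le> 1"
    and J: "finite J" "J \<noteq> {}"
    and phi: "is_frame V1 A B J \<phi>"
    and \<epsilon>: "0 < \<epsilon>" "\<epsilon> < A"
    and \<alpha>: "(\<lambda>n. (\<alpha> n)\<^sup>2) summable_on {2..}" "(\<Sum>\<^sub>\<infinity>n\<in>{2..}. (\<alpha> n)\<^sup>2) \<le> \<epsilon> / 2"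
  shows "is_frame UNIV ((1 - sqrt (\<epsilon> / A))\<^sup>2 * A) ((1 + sqrt \<epsilon>)\<^sup>2)
    (Phi_index I J) (Phi J e \<alpha> \<psi> \<phi>)"
proof -
  have "0 < A"
    using \<epsilon> by simp
  have phi_V1: "\<phi> j \<in> V1" if "j \<in> J" for j
    using phi that by (simp add: is_frame_def)
  define s where "s = 1 / sqrt (2 * real (card J))"
  have card: "0 < real (card J)"
    using J by (simp add: card_gt_0_iff)
  have s2: "s\<^sup>2 = 1 / (2 * real (card J))"
    by (simp add: s_def power_divide)
  define K where "K = Phi_index I J"
  have frame: "(\<lambda>k. (cmod (cinner f (Phi J e \<alpha> \<psi> \<phi> k)))\<^sup>2) summable_on K
      \<and> (1 - sqrt (\<epsilon> / A))\<^sup>2 * A * (norm f)\<^sup>2 \<le> (\<Sum>\<^sub>\<infinity>k\<in>K. (cmod (cinner f (Phi J e \<alpha> \<psi> \<phi> k)))\<^sup>2)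
      \<and> (\<Sum>\<^sub>\<infinity>k\<in>K. (cmod (cinner f (Phi J e \<alpha> \<psi> \<phi> k)))\<^sup>2) \<le> (1 + sqrt \<epsilon>)\<^sup>2 * (norm f)\<^sup>2" for f
  proof -
    define T where "T k = cinner f (Phi J e \<alpha> \<psi> \<phi> k)" for k
    define a where "a k = (case k of Inl i \<Rightarrow> cinner f (\<psi> i)
      | Inr (Inl (j, n)) \<Rightarrow> of_real s * cinner f (e n)
      | Inr (Inr (j, n)) \<Rightarrow> \<i> * (of_real s * cinner f (e n)))" for k :: "'b + 'c \<times> nat + 'c \<times> nat"
    define b where "b k = (case k of Inl i \<Rightarrow> 0
      | Inr (Inl (j, n)) \<Rightarrow> of_real (\<alpha> n) * cinner (P f) (\<phi> j)
      | Inr (Inr (j, n)) \<Rightarrow> of_real (\<alpha> n) * cinner (P f) (\<phi> j))" for k :: "'b + 'c \<times> nat + 'c \<times> nat"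
    have T: "T k = a k + b k" if "k \<in> K" for k
      using that phi_V1
      by (auto simp: K_def Phi_index_def T_def a_def b_def s_def cinner_Phi add.commute
          simp del: of_real_divide)
    define Sp where "Sp = (\<Sum>\<^sub>\<infinity>i\<in>I. (cmod (cinner (P f) (\<psi> i)))\<^sup>2)"
    have psi': "(\<lambda>i. (cmod (cinner (P f) (\<psi> i)))\<^sup>2) summable_on I"
      "A * (norm (P f))\<^sup>2 \<le> Sp" "Sp \<le> B * (norm (P f))\<^sup>2"
      using psi P_in[of f] by (auto simp: is_frame_def Sp_def)
    have "((\<lambda>i. (cmod (cinner (P f) (\<psi> i)))\<^sup>2) has_sum Sp) I"
      unfolding Sp_def using psi'(1) by (rule has_sum_infsum)
    then have a1: "((\<lambda>i. (cmod (a (Inl i)))\<^sup>2) has_sum Sp) I"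
      using psi cinner_P[of "\<psi> _" f] by (simp add: a_def is_frame_def cong: has_sum_cong)
    \<comment> \<open>Each phase carries half of the orthogonal energy, since
      \<open>s\<^sup>2 * card J = 1 / 2\<close>.\<close>
    have half: "(\<Sum>j\<in>J. s\<^sup>2 * (norm (f - P f))\<^sup>2) = (norm (f - P f))\<^sup>2 / 2"
      using card by (simp add: s2)
    have "((\<lambda>k. s\<^sup>2 * (cmod (cinner f (e (snd k))))\<^sup>2) has_sum
        (norm (f - P f))\<^sup>2 / 2) (J \<times> {2..})"
      unfolding half[symmetric]
      by (intro has_sum_finite_Times J) (auto intro!: has_sum_cmult_right coeff_has_sum)
    then have "((\<lambda>k. (cmod (a (Inr (Inl k))))\<^sup>2) has_sum (norm (f - P f))\<^sup>2 / 2) (J \<times> {2..})"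
      "((\<lambda>k. (cmod (a (Inr (Inr k))))\<^sup>2) has_sum (norm (f - P f))\<^sup>2 / 2) (J \<times> {2..})"
      by (simp_all add: a_def norm_mult power_mult_distrib case_prod_unfold)
    from has_sum_Plus[OF a1 has_sum_Plus[OF this]]
    have a: "((\<lambda>k. (cmod (a k))\<^sup>2) has_sum (Sp + (norm (f - P f))\<^sup>2)) K"
      by (simp add: K_def Phi_index_def)
    define b0 where "b0 = (\<Sum>\<^sub>\<infinity>n\<in>{2..}. (\<alpha> n)\<^sup>2) * (\<Sum>j\<in>J. (cmod (cinner (P f) (\<phi> j)))\<^sup>2)"
    have "((\<lambda>(j, n). (\<alpha> n)\<^sup>2 * (cmod (cinner (P f) (\<phi> j)))\<^sup>2) has_sum
        (\<Sum>j\<in>J. (\<Sum>\<^sub>\<infinity>n\<in>{2..}. (\<alpha> n)\<^sup>2) * (cmod (cinner (P f) (\<phi> j)))\<^sup>2)) (J \<times> {2..})"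
      by (intro has_sum_finite_Times J) (auto intro!: has_sum_cmult_left has_sum_infsum \<alpha>)
    then have b23: "((\<lambda>k. (cmod (b (Inr (Inl k))))\<^sup>2) has_sum b0) (J \<times> {2..})"
      "((\<lambda>k. (cmod (b (Inr (Inr k))))\<^sup>2) has_sum b0) (J \<times> {2..})"
      by (simp_all add: b_def b0_def norm_mult power_mult_distrib case_prod_unfold sum_distrib_left)
    have b1: "((\<lambda>i. (cmod (b (Inl i)))\<^sup>2) has_sum 0) I"
      by (simp add: b_def)
    from has_sum_Plus[OF b1 has_sum_Plus[OF b23]]
    have b: "((\<lambda>k. (cmod (b k))\<^sup>2) has_sum (2 * b0)) K"
      by (simp add: K_def Phi_index_def)
    have "(\<Sum>j\<in>J. (cmod (cinner (P f) (\<phi> j)))\<^sup>2) \<le> B * (norm (P f))\<^sup>2"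
      using phi P_in[of f] J by (simp add: is_frame_def)
    also have "\<dots> \<le> (norm f)\<^sup>2"
    proof -
      have "B * (norm (P f))\<^sup>2 \<le> (norm (P f))\<^sup>2"
        using mult_right_mono[OF AB(2), of "(norm (P f))\<^sup>2"] by simp
      also have "\<dots> \<le> (norm f)\<^sup>2"
        unfolding norm_P_split[of f] by simp
      finally show ?thesis .
    qed
    finally have bessel: "(\<Sum>j\<in>J. (cmod (cinner (P f) (\<phi> j)))\<^sup>2) \<le> (norm f)\<^sup>2" .
    have "b0 \<le> \<epsilon> / 2 * (norm f)\<^sup>2"
      unfolding b0_def
    proof (rule mult_mono[OF \<alpha>(2) bessel])
      show "0 \<le> \<epsilon> / 2"
        using \<epsilon> by simp
      show "0 \<le> (\<Sum>j\<in>J. (cmod (cinner (P f) (\<phi> j)))\<^sup>2)"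
        by (rule sum_nonneg) simp
    qed
    then have b_le: "2 * b0 \<le> \<epsilon> * (norm f)\<^sup>2"
      by simp
    have a_le: "Sp + (norm (f - P f))\<^sup>2 \<le> (norm f)\<^sup>2"
      using psi'(3) mult_right_mono[OF AB(2), of "(norm (P f))\<^sup>2"] norm_P_split[of f] by simp
    have a_ge: "A * (norm f)\<^sup>2 \<le> Sp + (norm (f - P f))\<^sup>2"
    proof -
      have "A * (norm f)\<^sup>2 = A * (norm (P f))\<^sup>2 + A * (norm (f - P f))\<^sup>2"
        by (simp add: norm_P_split[of f] distrib_left)
      then show ?thesis
        using psi'(2) AB mult_right_mono[of A 1 "(norm (f - P f))\<^sup>2"] by simp
    qed
    have young: "((\<lambda>k. x * (cmod (a k))\<^sup>2 + y * (cmod (b k))\<^sup>2) has_sum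
        x * (Sp + (norm (f - P f))\<^sup>2) + y * (2 * b0)) K" for x y
      by (intro has_sum_add has_sum_cmult_right a b)
    define t where "t = sqrt \<epsilon>"
    have t: "0 < t" "\<epsilon> = t\<^sup>2"
      using \<epsilon> by (simp_all add: t_def)
    have upper: "(cmod (T k))\<^sup>2 \<le> (1 + t) * (cmod (a k))\<^sup>2 + (1 + 1 / t) * (cmod (b k))\<^sup>2"
      if "k \<in> K" for k
      unfolding T[OF that] using t(1) by (rule young_upper)
    have summable: "(\<lambda>k. (cmod (T k))\<^sup>2) summable_on K"
      using summable_on_comparison_test[OF has_sum_imp_summable[OF young[of "1 + t" "1 + 1 / t"]]]
        upper by simp
    have "(\<Sum>\<^sub>\<infinity>k\<in>K. (cmod (T k))\<^sup>2) \<le> (1 + t) * (Sp + (norm (f - P f))\<^sup>2) + (1 + 1 / t) * (2 * b0)"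
      using has_sum_mono[OF has_sum_infsum[OF summable] young upper] .
    also have "\<dots> \<le> (1 + t) * (norm f)\<^sup>2 + (1 + 1 / t) * (\<epsilon> * (norm f)\<^sup>2)"
      using a_le b_le t(1) by (intro add_mono mult_left_mono) auto
    also have "\<dots> = (1 + t)\<^sup>2 * (norm f)\<^sup>2"
      using t(1) unfolding t(2) by (simp add: field_simps power2_eq_square)
    finally have le: "(\<Sum>\<^sub>\<infinity>k\<in>K. (cmod (T k))\<^sup>2) \<le> (1 + t)\<^sup>2 * (norm f)\<^sup>2" .
    define r where "r = sqrt (\<epsilon> / A)"
    have r: "0 < r" "r < 1" "\<epsilon> = r\<^sup>2 * A"
      using \<epsilon> \<open>0 < A\<close> by (simp_all add: r_def)
    have lower: "(1 - r) * (cmod (a k))\<^sup>2 + (1 - 1 / r) * (cmod (b k))\<^sup>2 \<le> (cmod (T k))\<^sup>2"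
      if "k \<in> K" for k
      unfolding T[OF that] using young_lower[OF r(1), of "a k" "b k"] by (simp add: left_diff_distrib)
    \<comment> \<open>With \<open>\<epsilon> = r\<^sup>2 * A\<close> the loss becomes a multiple of
      \<open>A * (norm f)\<^sup>2\<close>, and \<open>(1 - r) + (r\<^sup>2 - r)\<close> is
      \<open>(1 - r)\<^sup>2\<close>.\<close>
    have "(1 - 1 / r) * r\<^sup>2 = r\<^sup>2 - r"
      using r(1) by (simp add: left_diff_distrib power2_eq_square)
    then have eq: "(1 - 1 / r) * (\<epsilon> * (norm f)\<^sup>2) = (r\<^sup>2 - r) * (A * (norm f)\<^sup>2)"
      unfolding r(3) by (simp only: mult.assoc[symmetric])
    have "(1 - r)\<^sup>2 * A * (norm f)\<^sup>2
        = (1 - r) * (A * (norm f)\<^sup>2) + (1 - 1 / r) * (\<epsilon> * (norm f)\<^sup>2)"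
      unfolding eq by (simp add: power2_eq_square algebra_simps)
    \<comment> \<open>Since \<open>r < 1\<close>, the factor \<open>1 - 1 / r\<close> is negative,
      so the upper bound on \<open>b0\<close> works as a lower bound here.\<close>
    also have "\<dots> \<le> (1 - r) * (Sp + (norm (f - P f))\<^sup>2) + (1 - 1 / r) * (2 * b0)"
      using r(1,2) by (intro add_mono mult_left_mono[OF a_ge] mult_left_mono_neg[OF b_le]) simp_all
    also have "\<dots> \<le> (\<Sum>\<^sub>\<infinity>k\<in>K. (cmod (T k))\<^sup>2)"
      using has_sum_mono[OF young has_sum_infsum[OF summable] lower] .
    finally have "(1 - r)\<^sup>2 * A * (norm f)\<^sup>2 \<le> (\<Sum>\<^sub>\<infinity>k\<in>K. (cmod (T k))\<^sup>2)" .
    then show ?thesis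
      using summable le unfolding T_def r_def t_def by (intro conjI)
  qed
  have "sqrt (\<epsilon> / A) < 1"
    using \<epsilon> \<open>0 < A\<close> by simp
  then have "0 < (1 - sqrt (\<epsilon> / A))\<^sup>2 * A"
    using \<open>0 < A\<close> by simp
  with frame show ?thesis
    unfolding is_frame_def K_def by blast
qed

text \<open>At each good index \<open>j\<close> the coefficients of \<open>f\<close> and of
  \<open>g\<close> against \<open>e n\<close> are small compared with the same
  \<open>\<alpha> n * cinner (P f) (\<phi> j)\<close>, so the two-phase estimate recovers their
  difference. Averaging over \<open>G\<close> costs the factor \<open>\<kappa>\<close>; exchanging
  the reference value of \<open>g\<close> for that of \<open>f\<close> costs a multiple of the
  squared distance of the projections, by \<open>bessel\<close>.\<close>

lemma norm_diff_le_coeffs: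
  fixes f g :: 'a
  assumes J: "finite J" "J \<noteq> {}"
    and phi_V1: "\<And>j. j \<in> J \<Longrightarrow> \<phi> j \<in> V1"
    and bessel: "\<And>x. x \<in> V1 \<Longrightarrow> (\<Sum>j\<in>J. (cmod (cinner x (\<phi> j)))\<^sup>2) \<le> (norm x)\<^sup>2"
    and G: "G \<subseteq> J" "real (card J) \<le> \<kappa> * real (card G)"
    and \<kappa>: "0 < \<kappa>"
    and small: "\<And>n j. n \<ge> 2 \<Longrightarrow> j \<in> G \<Longrightarrow>
        cmod (cinner f (e n)) \<le> cmod (\<alpha> n * cinner (P f) (\<phi> j)) / 32"
      "\<And>n j. n \<ge> 2 \<Longrightarrow> j \<in> G \<Longrightarrow>
        cmod (cinner g (e n)) \<le> cmod (\<alpha> n * cinner (P f) (\<phi> j)) / 32"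
    and \<alpha>: "(\<lambda>n. (\<alpha> n)\<^sup>2) summable_on {2..}"
    and D_def: "\<And>j n. D j n
      = (cmod (cinner f (Phi J e \<alpha> \<psi> \<phi> (Inr (Inl (j, n)))))
          - cmod (cinner g (Phi J e \<alpha> \<psi> \<phi> (Inr (Inl (j, n))))))\<^sup>2
      + (cmod (cinner f (Phi J e \<alpha> \<psi> \<phi> (Inr (Inr (j, n)))))
          - cmod (cinner g (Phi J e \<alpha> \<psi> \<phi> (Inr (Inr (j, n))))))\<^sup>2"
    and D: "(\<lambda>n. \<Sum>j\<in>J. D j n) summable_on {2..}"
  shows "(norm (f - g))\<^sup>2 \<le> (1 + 32 * \<kappa> * (\<Sum>\<^sub>\<infinity>n\<in>{2..}. (\<alpha> n)\<^sup>2)) * (norm (P f - P g))\<^sup>2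
    + 16 * \<kappa> * (\<Sum>\<^sub>\<infinity>n\<in>{2..}. \<Sum>j\<in>J. D j n)"
proof -
  define s where "s = 1 / sqrt (2 * real (card J))"
  have card: "1 \<le> real (card J)"
    using J by (simp add: Suc_le_eq card_gt_0_iff)
  have s2: "s\<^sup>2 = 1 / (2 * real (card J))"
    by (simp add: s_def power_divide)
  have s: "0 \<le> s" "s \<le> 1"
    using card by (auto simp: s_def real_le_rsqrt)
  define x where "x = P f - P g"
  have Px: "P (f - g) = x"
    using P_diff_scaleC[of f 1 g] by (simp add: scaleC_one x_def)
  have x: "x \<in> V1"
    using P_in[of "f - g"] by (simp add: Px)
  have step: "(cmod (cinner (f - g) (e n)))\<^sup>2
      \<le> 16 * \<kappa> * (\<Sum>j\<in>J. D j n) + 32 * \<kappa> * (norm x)\<^sup>2 * (\<alpha> n)\<^sup>2" if n: "n \<ge> 2" for n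
  proof -
    define h where "h = (cmod (cinner (f - g) (e n)))\<^sup>2"
    define u where "u = of_real s * cinner f (e n)"
    define v where "v = of_real s * cinner g (e n)"
    have "s\<^sup>2 * h \<le> 8 * D j n + 16 * ((\<alpha> n)\<^sup>2 * (cmod (cinner x (\<phi> j)))\<^sup>2)" if "j \<in> G" for j
    proof -
      define a where "a = \<alpha> n * cinner (P f) (\<phi> j)"
      define b where "b = \<alpha> n * cinner (P g) (\<phi> j)"
      have "\<phi> j \<in> V1"
        using that G(1) phi_V1 by auto
      then have Deq: "D j n = (cmod (a + u) - cmod (b + v))\<^sup>2
          + (cmod (a + \<i> * u) - cmod (b + \<i> * v))\<^sup>2"
        unfolding D_def a_def b_def u_def v_def s_def by (simp only: cinner_Phi)
      have "cmod u \<le> cmod a / 32" "cmod v \<le> cmod a / 32"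
        using small[OF n that] s
          mult_left_le_one_le[of "cmod (cinner f (e n))" s]
          mult_left_le_one_le[of "cmod (cinner g (e n))" s]
        unfolding u_def v_def a_def by (auto simp: norm_mult)
      note two = cmod_diff_le_two_phases[OF this]
      \<comment> \<open>In \<open>D\<close> the reference value for \<open>g\<close> is
        \<open>b\<close>, whereas \<open>two\<close> has \<open>a\<close> in both places. The
        exchange costs at most \<open>cmod (a - b)\<close>; \<open>4 * 2\<close> and
        \<open>4 * (2 + 2)\<close> give the factors 8 and 16.\<close>
      have sq: "(cmod (a + w) - cmod (a + z))\<^sup>2
          \<le> 2 * (cmod (a + w) - cmod (b + z))\<^sup>2 + 2 * (cmod (a - b))\<^sup>2" for w z
      proof -
        have "\<bar>cmod (b + z) - cmod (a + z)\<bar> \<le> \<bar>cmod (a - b)\<bar>"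
          using norm_triangle_ineq3[of "b + z" "a + z"] by (simp add: norm_minus_commute)
        then have "(cmod (b + z) - cmod (a + z))\<^sup>2 \<le> (cmod (a - b))\<^sup>2"
          by (simp only: abs_le_square_iff)
        moreover have "(p + q)\<^sup>2 \<le> 2 * p\<^sup>2 + 2 * q\<^sup>2" for p q :: real
          using zero_le_power2[of "p - q"] by (simp add: power2_eq_square algebra_simps)
        from this[of "cmod (a + w) - cmod (b + z)" "cmod (b + z) - cmod (a + z)"]
        have "(cmod (a + w) - cmod (a + z))\<^sup>2
          \<le> 2 * (cmod (a + w) - cmod (b + z))\<^sup>2 + 2 * (cmod (b + z) - cmod (a + z))\<^sup>2"
          by simp
        ultimately show ?thesis
          by linarith
      qed
      have "u - v = of_real s * cinner (f - g) (e n)"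
        by (simp add: u_def v_def cinner_diff_left right_diff_distrib)
      then have uv: "s\<^sup>2 * h = (cmod (u - v))\<^sup>2"
        by (simp add: h_def norm_mult power_mult_distrib)
      have "a - b = of_real (\<alpha> n) * cinner x (\<phi> j)"
        by (simp add: a_def b_def x_def cinner_diff_left right_diff_distrib)
      then have ab: "(cmod (a - b))\<^sup>2 = (\<alpha> n)\<^sup>2 * (cmod (cinner x (\<phi> j)))\<^sup>2"
        by (simp add: norm_mult power_mult_distrib)
      have "q \<le> 8 * (X + Y) + 16 * Z"
        if "q \<le> 4 * (p + p')" "p \<le> 2 * X + 2 * Z" "p' \<le> 2 * Y + 2 * Z" for q p p' X Y Z :: real
        using that by simp
      from this[OF two sq sq] show ?thesis
        unfolding Deq uv ab .
    qed
    then have "real (card G) * (s\<^sup>2 * h)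
        \<le> (\<Sum>j\<in>G. 8 * D j n + 16 * ((\<alpha> n)\<^sup>2 * (cmod (cinner x (\<phi> j)))\<^sup>2))"
      using sum_mono[of G "\<lambda>_. s\<^sup>2 * h"] by simp
    \<comment> \<open>All terms are nonnegative, so the sum can be enlarged to \<open>J\<close>,
      where \<open>bessel\<close> applies.\<close>
    also have "\<dots> \<le> (\<Sum>j\<in>J. 8 * D j n + 16 * ((\<alpha> n)\<^sup>2 * (cmod (cinner x (\<phi> j)))\<^sup>2))"
      using J G(1) by (intro sum_mono2) (auto simp: D_def)
    also have "\<dots> = 8 * (\<Sum>j\<in>J. D j n) + 16 * ((\<alpha> n)\<^sup>2 * (\<Sum>j\<in>J. (cmod (cinner x (\<phi> j)))\<^sup>2))"
      by (simp add: sum.distrib sum_distrib_left)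
    also have "\<dots> \<le> 8 * (\<Sum>j\<in>J. D j n) + 16 * ((\<alpha> n)\<^sup>2 * (norm x)\<^sup>2)"
      using bessel[OF x] by (intro add_left_mono mult_left_mono) auto
    finally have 1: "real (card G) * (s\<^sup>2 * h)
        \<le> 8 * (\<Sum>j\<in>J. D j n) + 16 * ((\<alpha> n)\<^sup>2 * (norm x)\<^sup>2)" .
    \<comment> \<open>The factor \<open>card J\<close> hidden in \<open>s\<^sup>2\<close> is traded
      for \<open>\<kappa> * card G\<close>.\<close>
    have "h = real (card J) * (2 * (s\<^sup>2 * h))"
      using card by (simp add: s2)
    also have "\<dots> \<le> \<kappa> * real (card G) * (2 * (s\<^sup>2 * h))"
      using G(2) by (intro mult_right_mono) (auto simp: h_def)
    also have "\<dots> = 2 * \<kappa> * (real (card G) * (s\<^sup>2 * h))"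
      by simp
    also have "\<dots> \<le> 2 * \<kappa> * (8 * (\<Sum>j\<in>J. D j n) + 16 * ((\<alpha> n)\<^sup>2 * (norm x)\<^sup>2))"
      using 1 \<kappa> by (intro mult_left_mono) auto
    finally show ?thesis
      unfolding h_def by (simp add: algebra_simps)
  qed
  \<comment> \<open>As \<open>x\<close> is the projection of \<open>f - g\<close>, the vector
    \<open>f - g - x\<close> is the orthogonal part, computed from its coefficients.\<close>
  have "(norm (f - g - x))\<^sup>2 \<le> 16 * \<kappa> * (\<Sum>\<^sub>\<infinity>n\<in>{2..}. \<Sum>j\<in>J. D j n)
      + 32 * \<kappa> * (norm x)\<^sup>2 * (\<Sum>\<^sub>\<infinity>n\<in>{2..}. (\<alpha> n)\<^sup>2)"
  proof (rule has_sum_mono)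
    show "((\<lambda>n. (cmod (cinner (f - g) (e n)))\<^sup>2) has_sum (norm (f - g - x))\<^sup>2) {2..}"
      using coeff_has_sum[of "f - g"] by (simp add: Px)
    show "((\<lambda>n. 16 * \<kappa> * (\<Sum>j\<in>J. D j n) + 32 * \<kappa> * (norm x)\<^sup>2 * (\<alpha> n)\<^sup>2) has_sum
      16 * \<kappa> * (\<Sum>\<^sub>\<infinity>n\<in>{2..}. \<Sum>j\<in>J. D j n)
      + 32 * \<kappa> * (norm x)\<^sup>2 * (\<Sum>\<^sub>\<infinity>n\<in>{2..}. (\<alpha> n)\<^sup>2)) {2..}"
      by (intro has_sum_add has_sum_cmult_right has_sum_infsum D \<alpha>)
  qed (use step in auto)
  then show ?thesis
    using norm_P_split[of "f - g"] by (simp add: Px x_def[symmetric] algebra_simps)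
qed

text \<open>By the reverse triangle inequality the terms are dominated by the squared frame
  coefficients of \<open>f - g\<close>.\<close>

lemma Phi_magnitudes_diff_summable:
  assumes "is_frame UNIV A' B' (Phi_index I J) (Phi J e \<alpha> \<psi> \<phi>)"
  shows "(\<lambda>k. (frame_magnitudes (Phi J e \<alpha> \<psi> \<phi>) f k
    - frame_magnitudes (Phi J e \<alpha> \<psi> \<phi>) g k)\<^sup>2) summable_on Phi_index I J"
proof (rule summable_on_comparison_test)
  show "(\<lambda>k. (cmod (cinner (f - g) (Phi J e \<alpha> \<psi> \<phi> k)))\<^sup>2) summable_on Phi_index I J"
    using assms by (simp add: is_frame_def)
  show "(frame_magnitudes (Phi J e \<alpha> \<psi> \<phi>) f k - frame_magnitudes (Phi J e \<alpha> \<psi> \<phi>) g k)\<^sup>2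
    \<le> (cmod (cinner (f - g) (Phi J e \<alpha> \<psi> \<phi> k)))\<^sup>2" for k
    using norm_triangle_ineq3[of "cinner f (Phi J e \<alpha> \<psi> \<phi> k)" "cinner g (Phi J e \<alpha> \<psi> \<phi> k)"]
    unfolding frame_magnitudes_def cinner_diff_left abs_le_square_iff[symmetric] by simp
qed simp

text \<open>Summability lets the sum be split into the three families; \<open>D\<close> joins the
  two phases at the same \<open>(j, n)\<close>, the form in which the stability estimate uses
  them.\<close>

lemma ell2_norm_Phi:
  assumes "is_frame UNIV A' B' (Phi_index I J) (Phi J e \<alpha> \<psi> \<phi>)" "finite J"
    and D_def: "\<And>j n. D j n
      = (cmod (cinner f (Phi J e \<alpha> \<psi> \<phi> (Inr (Inl (j, n)))))
          - cmod (cinner g (Phi J e \<alpha> \<psi> \<phi> (Inr (Inl (j, n))))))\<^sup>2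
      + (cmod (cinner f (Phi J e \<alpha> \<psi> \<phi> (Inr (Inr (j, n)))))
          - cmod (cinner g (Phi J e \<alpha> \<psi> \<phi> (Inr (Inr (j, n))))))\<^sup>2"
  shows "(\<lambda>n. \<Sum>j\<in>J. D j n) summable_on {2..}"
    "(ell2_norm (Phi_index I J) (\<lambda>k. frame_magnitudes (Phi J e \<alpha> \<psi> \<phi>) f k
        - frame_magnitudes (Phi J e \<alpha> \<psi> \<phi>) g k))\<^sup>2
      = (\<Sum>\<^sub>\<infinity>i\<in>I. (cmod (cinner f (\<psi> i)) - cmod (cinner g (\<psi> i)))\<^sup>2)
        + (\<Sum>\<^sub>\<infinity>n\<in>{2..}. \<Sum>j\<in>J. D j n)"
proof -
  define h where "h k = (frame_magnitudes (Phi J e \<alpha> \<psi> \<phi>) f k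
    - frame_magnitudes (Phi J e \<alpha> \<psi> \<phi>) g k)\<^sup>2" for k
  have h: "h summable_on (I <+> ((J \<times> {2..}) <+> (J \<times> {2..})))"
    using Phi_magnitudes_diff_summable[OF assms(1), of f g] by (simp add: h_def[abs_def] Phi_index_def)
  note h1 = infsum_Plus[OF h]
  note h2 = infsum_Plus[OF h1(2)]
  note l = infsum_finite_Times[OF assms(2) h2(1)]
  note r = infsum_finite_Times[OF assms(2) h2(2)]
  have D: "(\<Sum>j\<in>J. D j n) = (\<Sum>j\<in>J. h (Inr (Inl (j, n)))) + (\<Sum>j\<in>J. h (Inr (Inr (j, n))))" for n
    by (simp add: D_def h_def frame_magnitudes_def sum.distrib)
  show "(\<lambda>n. \<Sum>j\<in>J. D j n) summable_on {2..}"
    unfolding D by (intro summable_on_add l(1) r(1))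
  have "0 \<le> infsum h (Phi_index I J)"
    by (intro infsum_nonneg) (simp add: h_def)
  then have "(ell2_norm (Phi_index I J) (\<lambda>k. frame_magnitudes (Phi J e \<alpha> \<psi> \<phi>) f k
        - frame_magnitudes (Phi J e \<alpha> \<psi> \<phi>) g k))\<^sup>2 = infsum h (Phi_index I J)"
    unfolding ell2_norm_def h_def by (rule real_sqrt_pow2)
  also have "\<dots> = (\<Sum>\<^sub>\<infinity>i\<in>I. h (Inl i)) + (\<Sum>\<^sub>\<infinity>n\<in>{2..}. \<Sum>j\<in>J. D j n)"
    unfolding D infsum_add[OF l(1) r(1)] Phi_index_def h1(3) h2(3) l(2) r(2) by simp
  also have "(\<Sum>\<^sub>\<infinity>i\<in>I. h (Inl i)) = (\<Sum>\<^sub>\<infinity>i\<in>I. (cmod (cinner f (\<psi> i)) - cmod (cinner g (\<psi> i)))\<^sup>2)"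
    by (simp add: h_def frame_magnitudes_def cinner_Phi(1))
  finally show "(ell2_norm (Phi_index I J) (\<lambda>k. frame_magnitudes (Phi J e \<alpha> \<psi> \<phi>) f k
        - frame_magnitudes (Phi J e \<alpha> \<psi> \<phi>) g k))\<^sup>2
      = (\<Sum>\<^sub>\<infinity>i\<in>I. (cmod (cinner f (\<psi> i)) - cmod (cinner g (\<psi> i)))\<^sup>2)
        + (\<Sum>\<^sub>\<infinity>n\<in>{2..}. \<Sum>j\<in>J. D j n)" .
qed

end

theorem theorem4p3:
  fixes V1 :: "'a::chilbert_space set"
    and e :: "nat \<Rightarrow> 'a"
    and I :: "'i set" and \<psi> :: "'i \<Rightarrow> 'a"
    and J :: "'j set" and \<phi> :: "'j \<Rightarrow> 'a"
    and N :: nat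
    and A B C c \<kappa> \<epsilon> :: real
    and \<alpha> \<beta> :: "nat \<Rightarrow> real"
  assumes separable: "\<exists>D :: 'a set. countable D \<and> closure D = UNIV"
    and infinite_dim: "\<not> cfinite_dim (UNIV :: 'a set)"
    and V1: "csubspace V1" "cfinite_dim V1"
    and N: "N = cdim V1"
    and e: "is_onb (orth_compl V1) {2..} e"
    and AB: "0 < A" "A \<le> B" "B \<le> 1"
    and C: "C > 0"
    and psi_frame: "is_frame V1 A B I \<psi>"
    and psi_stable: "\<And>x y. x \<in> V1 \<Longrightarrow> y \<in> V1 \<Longrightarrow>
          (INF a\<in>{a. cmod a = 1}. (norm (x - scaleC a y))\<^sup>2)
            \<le> C * (\<Sum>\<^sub>\<infinity>j\<in>I. \<bar>cmod (cinner x (\<psi> j)) - cmod (cinner y (\<psi> j))\<bar>\<^sup>2)"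
    and J: "finite J" "J \<noteq> {}"
    and phi_frame: "is_frame V1 A B J \<phi>"
    and constants: "c > 0" "\<kappa> > 0" "0 < \<epsilon>" "\<epsilon> < min (1 / 8) A"
    and i: "\<And>x y. x \<in> V1 \<Longrightarrow> y \<in> V1 \<Longrightarrow>
          real (card J) \<le> \<kappa> * real (card {j \<in> J.
            (1 / c) * norm x \<ge> sqrt (real N) * cmod (cinner x (\<phi> j)) \<and>
            sqrt (real N) * cmod (cinner x (\<phi> j)) \<ge> c * norm x \<and>
            (1 / c) * norm y \<ge> sqrt (real N) * cmod (cinner y (\<phi> j)) \<and>
            sqrt (real N) * cmod (cinner y (\<phi> j)) \<ge> c * norm y})"
    and ii: "(\<lambda>n. (\<alpha> n)\<^sup>2) summable_on {2..}"
        "(\<Sum>\<^sub>\<infinity>n\<in>{2..}. (\<alpha> n)\<^sup>2)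
            \<le> \<epsilon>\<^sup>2 * (1 / 11) * (1 / real (card J)) * (1 / c\<^sup>2)
                * min (1 / C) ((1 / \<kappa>) * (1 / 64) * c\<^sup>2)"
    and iii: "\<And>n. n \<ge> 2 \<Longrightarrow> \<beta> n < (1 / 2 ^ 6) * c\<^sup>2 * (1 / sqrt (real N)) * \<alpha> n"
  shows "(\<forall>f\<in>Bset V1 e \<beta>. \<forall>g\<in>Bset V1 e \<beta>.
            (INF a\<in>{a. cmod a = 1}. (norm (f - scaleC a g))\<^sup>2)
              \<le> (1 / (1 - \<epsilon>)) * max C (64 * \<kappa> * (1 / c\<^sup>2))
                  * (ell2_norm (Phi_index I J)
                      (\<lambda>k. frame_magnitudes (Phi J e \<alpha> \<psi> \<phi>) f k
                           - frame_magnitudes (Phi J e \<alpha> \<psi> \<phi>) g k))\<^sup>2)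
       \<and> is_frame UNIV ((1 - sqrt (\<epsilon> / A))\<^sup>2 * A) ((1 + sqrt \<epsilon>)\<^sup>2)
            (Phi_index I J) (Phi J e \<alpha> \<psi> \<phi>)"
proof -
  interpret onb_splitting V1 e
    by unfold_locales (fact V1 e)+
  define \<Phi> where "\<Phi> = Phi J e \<alpha> \<psi> \<phi>"
  define S where "S = (\<Sum>\<^sub>\<infinity>n\<in>{2..}. (\<alpha> n)\<^sup>2)"
  define M where "M = max C (64 * \<kappa> * (1 / c\<^sup>2))"
  define G where "G x = {j \<in> J. sqrt (real N) * cmod (cinner x (\<phi> j)) \<le> (1 / c) * norm x
    \<and> sqrt (real N) * cmod (cinner x (\<phi> j)) \<ge> c * norm x}" for x
  define R where "R f g = (ell2_norm (Phi_index I J)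
    (\<lambda>k. frame_magnitudes \<Phi> f k - frame_magnitudes \<Phi> g k))\<^sup>2" for f g

  \<comment> \<open>Consequences of the hypotheses on the constants\<close>
  have \<epsilon>: "0 < \<epsilon>" "\<epsilon> < A" "\<epsilon> \<le> 1 / 8"
    using constants by simp_all
  have card: "1 \<le> real (card J)"
    using J by (simp add: Suc_le_eq card_gt_0_iff)
  have phi_V1: "\<phi> j \<in> V1" if "j \<in> J" for j
    using phi_frame that by (simp add: is_frame_def)
  have bessel: "(\<Sum>j\<in>J. (cmod (cinner x (\<phi> j)))\<^sup>2) \<le> (norm x)\<^sup>2" if "x \<in> V1" for x
  proof -
    have "(\<Sum>j\<in>J. (cmod (cinner x (\<phi> j)))\<^sup>2) \<le> B * (norm x)\<^sup>2"
      using phi_frame that J by (simp add: is_frame_def)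
    also have "\<dots> \<le> 1 * (norm x)\<^sup>2"
      using AB(3) by (rule mult_right_mono) simp
    finally show ?thesis
      by simp
  qed
  \<comment> \<open>Hypothesis \<open>i\<close> with both vectors equal to \<open>x\<close>.\<close>
  have G: "real (card J) \<le> \<kappa> * real (card (G x))" if "x \<in> V1" for x
  proof -
    have "real (card J) \<le> \<kappa> * real (card {j \<in> J.
            (1 / c) * norm x \<ge> sqrt (real N) * cmod (cinner x (\<phi> j)) \<and>
            sqrt (real N) * cmod (cinner x (\<phi> j)) \<ge> c * norm x \<and>
            (1 / c) * norm x \<ge> sqrt (real N) * cmod (cinner x (\<phi> j)) \<and>
            sqrt (real N) * cmod (cinner x (\<phi> j)) \<ge> c * norm x})"
      by (rule i) (fact that)+
    also have "\<dots> \<le> \<kappa> * real (card (G x))"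
      using constants(2) J(1) unfolding G_def
      by (intro mult_left_mono of_nat_mono card_mono) auto
    finally show ?thesis .
  qed
  \<comment> \<open>Instance \<open>x = 0\<close>: a subset of the nonempty set \<open>J\<close> has
    at most \<open>card J\<close> elements.\<close>
  have \<kappa>: "1 \<le> \<kappa>"
  proof -
    have "real (card (G 0)) \<le> real (card J)"
      unfolding G_def using J(1) by (intro of_nat_mono card_mono) auto
    then have "\<kappa> * real (card (G 0)) \<le> \<kappa> * real (card J)"
      using constants(2) by (intro mult_left_mono) auto
    with G[of 0] have "real (card J) \<le> \<kappa> * real (card J)"
      using complex_vector.subspace_0[OF V1(1)] by linarith
    with card show ?thesis
      by simp
  qed
  \<comment> \<open>The second entry of the minimum cancels \<open>c\<^sup>2\<close> and
    \<open>\<kappa>\<close>, leaving \<open>32 / (11 * 64) = 1 / 22\<close>.\<close>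
  have S: "32 * \<kappa> * S \<le> \<epsilon>\<^sup>2"
  proof -
    have "S \<le> \<epsilon>\<^sup>2 * (1 / 11) * (1 / real (card J)) * (1 / c\<^sup>2) * ((1 / \<kappa>) * (1 / 64) * c\<^sup>2)"
      using order_trans[OF ii(2) mult_left_mono[OF min.cobounded2]] unfolding S_def by simp
    then have "32 * \<kappa> * S \<le> 32 * \<kappa> * (\<epsilon>\<^sup>2 * (1 / 11) * (1 / real (card J)) * (1 / c\<^sup>2) * ((1 / \<kappa>) * (1 / 64) * c\<^sup>2))"
      using constants(2) by (intro mult_left_mono) auto
    also have "\<dots> = \<epsilon>\<^sup>2 / 22 / real (card J)"
      using constants(1,2) card by (simp add: field_simps)
    also have "\<dots> \<le> \<epsilon>\<^sup>2"
      using card mult_left_mono[of 1 "22 * real (card J)" "\<epsilon>\<^sup>2"] by (simp add: field_simps)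
    finally show ?thesis .
  qed
  have S0: "0 \<le> S"
    unfolding S_def by (intro infsum_nonneg) simp
  have \<epsilon>2: "\<epsilon>\<^sup>2 \<le> \<epsilon>"
    using \<epsilon> mult_left_mono[of \<epsilon> 1 \<epsilon>] by (simp add: power2_eq_square)
  have S32: "32 * S \<le> \<epsilon>"
    using S \<epsilon>2 mult_right_mono[of 1 \<kappa> S] \<kappa> S0 by simp
  have frame: "is_frame UNIV ((1 - sqrt (\<epsilon> / A))\<^sup>2 * A) ((1 + sqrt \<epsilon>)\<^sup>2) (Phi_index I J) \<Phi>"
    unfolding \<Phi>_def
    by (rule is_frame_Phi[OF psi_frame AB(2,3) J phi_frame \<epsilon>(1,2) ii(1)])
      (use S32 \<epsilon> S0 in \<open>simp add: S_def[symmetric]\<close>)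
  have factor: "1 + \<epsilon> \<le> 1 / (1 - \<epsilon>)"
    using \<epsilon> by (simp add: field_simps)
  have M: "0 < M" "C \<le> M"
    using C by (simp_all add: M_def)
  have R0: "0 \<le> R f g" for f g
    by (simp add: R_def)
  have R_commute: "R f g = R g f" for f g
    by (simp add: R_def ell2_norm_def power2_commute[of "frame_magnitudes \<Phi> f _"])

  \<comment> \<open>For nonzero \<open>x\<close> there is a good index. Its two bounds together give
    \<open>c \<le> 1 / c\<close>, and its positive lower bound excludes
    \<open>N = 0\<close>.\<close>
  have c_le: "c \<le> 1" and N_pos: "1 \<le> sqrt (real N)" if x: "x \<in> V1" "x \<noteq> 0" for x
  proof -
    have "G x \<noteq> {}"
      using G[OF x(1)] card by auto
    then obtain j where j: "sqrt (real N) * cmod (cinner x (\<phi> j)) \<le> (1 / c) * norm x"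
      "c * norm x \<le> sqrt (real N) * cmod (cinner x (\<phi> j))"
      by (auto simp: G_def)
    have "c * norm x \<le> (1 / c) * norm x"
      using j by linarith
    then have "c \<le> 1 / c"
      by (rule mult_right_le_imp_le) (use x(2) in simp)
    then have "c\<^sup>2 \<le> 1\<^sup>2"
      using constants(1) by (simp add: field_simps power2_eq_square)
    then show "c \<le> 1"
      by (rule power2_le_imp_le) simp
    have "N \<noteq> 0"
    proof
      assume "N = 0"
      with j(2) have "c * norm x \<le> 0"
        by simp
      then show False
        using x(2) constants(1) by (simp add: mult_le_0_iff)
    qed
    then show "1 \<le> sqrt (real N)"
      by simp
  qed

  have \<beta>2: "\<beta> 2 \<le> 1 / 2"
  proof (cases "\<exists>x\<in>V1. x \<noteq> 0")
    case True
    then obtain x where "x \<in> V1" "x \<noteq> 0"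
      by blast
    note c1 = c_le[OF this] and N1 = N_pos[OF this]
    have "(\<alpha> 2)\<^sup>2 \<le> S"
      unfolding S_def
      using finite_sum_le_infsum[OF ii(1), of "{2}"] by simp
    also have "S \<le> 1\<^sup>2"
      using S32 S0 \<epsilon> by simp
    finally have \<alpha>2: "\<alpha> 2 \<le> 1"
      using abs_le_square_iff[of "\<alpha> 2" 1] by simp
    define K where "K = c\<^sup>2 * (1 / sqrt (real N))"
    have "c\<^sup>2 \<le> sqrt (real N)"
      using power_le_one[of c 2] c1 N1 constants(1) by linarith
    then have K: "0 \<le> K" "K \<le> 1"
      unfolding K_def using N1 by (simp_all add: divide_le_eq_1)
    have "\<beta> 2 \<le> K * \<alpha> 2 / 64"
      using iii[of 2] by (simp add: K_def)
    also have "\<dots> \<le> 1 / 64"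
      using mult_left_mono[OF \<alpha>2 K(1)] K by simp
    finally show ?thesis
      by simp
  next
    case False
    have "V1 \<subseteq> {0}"
      using False by blast
    then have "N = 0"
      unfolding N using complex_vector.dim_le_card[of V1 "{}"]
      by simp
    \<comment> \<open>Division by zero yields 0, so for \<open>N = 0\<close> hypothesis
      \<open>iii\<close> makes \<open>\<beta> 2\<close> negative.\<close>
    then show ?thesis
      using iii[of 2] by simp
  qed

  \<comment> \<open>Stability when \<open>P f\<close> is the larger projection\<close>
  have aligned: "\<exists>\<theta>. cmod \<theta> = 1 \<and> (norm (f - scaleC \<theta> g))\<^sup>2 \<le> 1 / (1 - \<epsilon>) * M * R f g"
    if f: "f \<in> Bset V1 e \<beta>" and g: "g \<in> Bset V1 e \<beta>" and le: "norm (P g) \<le> norm (P f)" for f g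
  \<comment> \<open>The ordering lets the good indices of \<open>P f\<close> serve both vectors. If
    \<open>P f = 0\<close>, both vectors vanish.\<close>
  proof (cases "P f = 0")
    case True
    then have "f = 0" "g = 0"
      using Bset_norm_le[OF f \<beta>2] Bset_norm_le[OF g \<beta>2] le by simp_all
    moreover have "0 \<le> 1 / (1 - \<epsilon>) * M * R f g"
      using M \<epsilon> R0 by simp
    ultimately show ?thesis
      by (intro exI[of _ 1]) (simp add: scaleC_one)
  next
    case False
    note c1 = c_le[OF P_in False] and N1 = N_pos[OF P_in False]
    have "f \<noteq> 0"
    proof
      assume "f = 0"
      then have "norm (P f) = 0"
        using norm_P_split[of f] by (simp add: sum_power2_eq_zero_iff add_nonneg_eq_0_iff)
      with False show False
        by simp
    qed
    obtain \<theta> where \<theta>: "cmod \<theta> = 1"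
      "\<And>a. cmod a = 1 \<Longrightarrow> (norm (P f - scaleC \<theta> (P g)))\<^sup>2 \<le> (norm (P f - scaleC a (P g)))\<^sup>2"
      using ex_optimal_phase[of "P f" "P g"] by blast
    define g' where "g' = scaleC \<theta> g"
    \<comment> \<open>Homogeneity of \<open>P\<close> is read off from the difference rule with
      first argument 0; its second instance gives \<open>P 0 = 0\<close>.\<close>
    have Pg': "P g' = scaleC \<theta> (P g)"
      using P_diff_scaleC[of 0 "- \<theta>" g] P_diff_scaleC[of 0 1 0]
      by (simp add: g'_def scaleC_one complex_vector.scale_minus_left)
    have mag: "cmod (cinner g' v) = cmod (cinner g v)" for v
      by (simp add: g'_def cinner_scaleC_left norm_mult \<theta>(1))
    define D where "D j n
      = (cmod (cinner f (Phi J e \<alpha> \<psi> \<phi> (Inr (Inl (j, n)))))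
          - cmod (cinner g' (Phi J e \<alpha> \<psi> \<phi> (Inr (Inl (j, n))))))\<^sup>2
      + (cmod (cinner f (Phi J e \<alpha> \<psi> \<phi> (Inr (Inr (j, n)))))
          - cmod (cinner g' (Phi J e \<alpha> \<psi> \<phi> (Inr (Inr (j, n))))))\<^sup>2" for j n
    define DI where "DI = (\<Sum>\<^sub>\<infinity>i\<in>I. (cmod (cinner f (\<psi> i)) - cmod (cinner g (\<psi> i)))\<^sup>2)"
    define DJ where "DJ = (\<Sum>\<^sub>\<infinity>n\<in>{2..}. \<Sum>j\<in>J. D j n)"
    have DJ0: "0 \<le> DJ"
      unfolding DJ_def by (intro infsum_nonneg sum_nonneg) (simp add: D_def)
    note split = ell2_norm_Phi[OF frame[unfolded \<Phi>_def] J(1) D_def]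
    have R_eq: "R f g = DI + DJ"
    proof -
      have "R f g = R f g'"
        by (simp add: R_def frame_magnitudes_def mag)
      also have "\<dots> = DI + DJ"
        unfolding R_def \<Phi>_def split(2) DI_def DJ_def by (simp add: mag)
      finally show ?thesis .
    qed
    have stable: "(norm (P f - P g'))\<^sup>2 \<le> C * DI"
    proof -
      \<comment> \<open>Optimality of \<open>\<theta>\<close> makes the left side a lower bound for
        all phases, so it lies below the infimum in the hypothesis on \<open>\<psi>\<close>.\<close>
      have "(norm (P f - P g'))\<^sup>2 \<le> (INF a\<in>{a. cmod a = 1}. (norm (P f - scaleC a (P g)))\<^sup>2)"
        unfolding Pg' using \<theta> by (intro cINF_greatest) auto
      also have "\<dots> \<le> C * (\<Sum>\<^sub>\<infinity>j\<in>I. \<bar>cmod (cinner (P f) (\<psi> j)) - cmod (cinner (P g) (\<psi> j))\<bar>\<^sup>2)"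
        by (intro psi_stable P_in)
      also have "(\<Sum>\<^sub>\<infinity>j\<in>I. \<bar>cmod (cinner (P f) (\<psi> j)) - cmod (cinner (P g) (\<psi> j))\<bar>\<^sup>2) = DI"
        unfolding DI_def
      proof (intro infsum_cong)
        fix j assume "j \<in> I"
        then have "\<psi> j \<in> V1"
          using psi_frame by (simp add: is_frame_def)
        then show "\<bar>cmod (cinner (P f) (\<psi> j)) - cmod (cinner (P g) (\<psi> j))\<bar>\<^sup>2
            = (cmod (cinner f (\<psi> j)) - cmod (cinner g (\<psi> j)))\<^sup>2"
          by (simp only: cinner_P[of _ f] cinner_P[of _ g] power2_abs)
      qed
      finally show ?thesis .
    qed
    have small: "cmod (cinner h (e n)) \<le> cmod (\<alpha> n * cinner (P f) (\<phi> j)) / 32"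
      if h: "h \<in> Bset V1 e \<beta>" "norm (P h) \<le> norm (P f)" and n: "n \<ge> 2" and j: "j \<in> G (P f)"
      for h n j
    proof -
      \<comment> \<open>\<open>K * c\<close> is the constant of \<open>iii\<close>; at the end
        \<open>2 * K * sqrt N = c / 32\<close>, and this \<open>c\<close> is at most 1.\<close>
      define K where "K = c / (64 * sqrt (real N))"
      have K0: "0 < K"
        using constants(1) N1 by (auto simp: K_def)
      have \<beta>_lt: "\<beta> n < K * c * \<alpha> n"
        using iii[OF n] by (simp add: K_def power2_eq_square)
      \<comment> \<open>The coefficient bound for the nonzero \<open>f\<close> forces
        \<open>\<beta> n\<close> to be nonnegative, and \<open>iii\<close> then forces
        \<open>\<alpha> n\<close> to be positive.\<close>
      have "0 \<le> \<beta> n * norm f"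
        using Bset_coeff[OF f n] norm_ge_zero[of "cinner f (e n)"] by linarith
      then have \<beta>0: "0 \<le> \<beta> n"
        using \<open>f \<noteq> 0\<close> by (simp add: zero_le_mult_iff)
      then have "0 < K * c * \<alpha> n"
        using \<beta>_lt by linarith
      then have \<alpha>0: "0 < \<alpha> n"
        using K0 constants(1) zero_less_mult_pos[of "K * c" "\<alpha> n"] by simp
      have "norm h \<le> 2 * norm (P f)"
        using Bset_norm_le[OF h(1) \<beta>2] h(2) by simp
      then have "cmod (cinner h (e n)) \<le> \<beta> n * (2 * norm (P f))"
        using Bset_coeff[OF h(1) n] mult_left_mono[OF _ \<beta>0] by (meson order_trans)
      also have "\<dots> \<le> K * c * \<alpha> n * (2 * norm (P f))"
        using \<beta>_lt by (intro mult_right_mono) auto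
      also have "\<dots> = 2 * K * \<alpha> n * (c * norm (P f))"
        by simp
      also have "\<dots> \<le> 2 * K * \<alpha> n * (sqrt (real N) * cmod (cinner (P f) (\<phi> j)))"
        using j K0 \<alpha>0 by (intro mult_left_mono) (auto simp: G_def)
      also have "\<dots> = c * (cmod (\<alpha> n * cinner (P f) (\<phi> j)) / 32)"
        using N1 \<alpha>0 by (simp add: K_def norm_mult field_simps)
      also have "\<dots> \<le> 1 * (cmod (\<alpha> n * cinner (P f) (\<phi> j)) / 32)"
        using c1 by (rule mult_right_mono) simp
      finally show ?thesis
        by simp
    qed
    have "(norm (f - g'))\<^sup>2 \<le> (1 + 32 * \<kappa> * S) * (norm (P f - P g'))\<^sup>2 + 16 * \<kappa> * DJ"
      unfolding S_def DJ_def
    proof (rule norm_diff_le_coeffs[OF J phi_V1 bessel _ G[OF P_in] constants(2) _ _ ii(1) D_def split(1)])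
      show "G (P f) \<subseteq> J"
        by (auto simp: G_def)
      show "cmod (cinner g' (e n)) \<le> cmod (\<alpha> n * cinner (P f) (\<phi> j)) / 32"
        if "n \<ge> 2" "j \<in> G (P f)" for n j
        unfolding mag by (rule small[OF g le that])
      show "cmod (cinner f (e n)) \<le> cmod (\<alpha> n * cinner (P f) (\<phi> j)) / 32"
        if "n \<ge> 2" "j \<in> G (P f)" for n j
        by (rule small[OF f order_refl that])
    qed
    also have "\<dots> \<le> (1 + \<epsilon>) * (C * DI) + 16 * \<kappa> * DJ"
      using order_trans[OF S \<epsilon>2] stable \<epsilon> by (intro add_right_mono mult_mono) simp_all
    also have "\<dots> \<le> (1 + \<epsilon>) * (M * DI) + (1 + \<epsilon>) * (M * DJ)"
    proof (rule add_mono)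
      have DI0: "0 \<le> DI"
        unfolding DI_def by (intro infsum_nonneg) simp
      show "(1 + \<epsilon>) * (C * DI) \<le> (1 + \<epsilon>) * (M * DI)"
        using M \<epsilon> DI0 by (intro mult_left_mono mult_right_mono) auto
      \<comment> \<open>\<open>c \<le> 1\<close> lets the constant in front of \<open>DJ\<close> be
        absorbed in \<open>M\<close>.\<close>
      have "16 * \<kappa> \<le> 64 * \<kappa> * (1 / c\<^sup>2)"
      proof -
        have "1 \<le> 1 / c\<^sup>2"
          using c1 constants(1) power_le_one[of c 2] by simp
        then have "64 * \<kappa> * 1 \<le> 64 * \<kappa> * (1 / c\<^sup>2)"
          using constants(2) by (intro mult_left_mono) auto
        then show ?thesis
          using constants(2) by linarith
      qed
      also have "\<dots> \<le> 1 * M"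
        by (simp add: M_def)
      also have "\<dots> \<le> (1 + \<epsilon>) * M"
        using M \<epsilon> by (intro mult_right_mono) auto
      finally show "16 * \<kappa> * DJ \<le> (1 + \<epsilon>) * (M * DJ)"
        unfolding mult.assoc[symmetric, of "1 + \<epsilon>"] using DJ0 by (rule mult_right_mono)
    qed
    also have "\<dots> = (1 + \<epsilon>) * (M * R f g)"
      by (simp add: R_eq distrib_left)
    also have "\<dots> \<le> 1 / (1 - \<epsilon>) * (M * R f g)"
      using factor M R0 by (intro mult_right_mono) auto
    finally show ?thesis
      using \<theta>(1) by (auto simp: g'_def mult.assoc)
  qed

  \<comment> \<open>Removal of the ordering and passage to the infimum\<close>
  have "(INF a\<in>{a. cmod a = 1}. (norm (f - scaleC a g))\<^sup>2) \<le> 1 / (1 - \<epsilon>) * M * R f g"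
    if f: "f \<in> Bset V1 e \<beta>" and g: "g \<in> Bset V1 e \<beta>" for f g
  proof -
    have "\<exists>\<theta>. cmod \<theta> = 1 \<and> (norm (f - scaleC \<theta> g))\<^sup>2 \<le> 1 / (1 - \<epsilon>) * M * R f g"
    proof (cases "norm (P g) \<le> norm (P f)")
      case True
      then show ?thesis
        by (rule aligned[OF f g])
    next
      case False
      then obtain \<theta> where \<theta>: "cmod \<theta> = 1"
        "(norm (g - scaleC \<theta> f))\<^sup>2 \<le> 1 / (1 - \<epsilon>) * M * R g f"
        using aligned[OF g f] by auto
      \<comment> \<open>In the swapped case the phase sits on \<open>f\<close>; its conjugate, which
        is its inverse, moves it to \<open>g\<close> without changing the norm.\<close>
      have "cnj \<theta> * \<theta> = 1"
        using complex_norm_square[of \<theta>] \<theta>(1) by (simp add: mult.commute)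
      then have "scaleC (cnj \<theta>) (g - scaleC \<theta> f) = scaleC (cnj \<theta>) g - f"
        by (simp add: complex_vector.scale_right_diff_distrib scaleC_scaleC scaleC_one)
      then have "norm (f - scaleC (cnj \<theta>) g) = norm (g - scaleC \<theta> f)"
        using norm_scaleC[of "cnj \<theta>" "g - scaleC \<theta> f"] \<theta>(1) by (simp add: norm_minus_commute)
      with \<theta> show ?thesis
        by (intro exI[of _ "cnj \<theta>"]) (simp add: R_commute[of f g])
    qed
    then obtain \<theta> where \<theta>: "cmod \<theta> = 1" "(norm (f - scaleC \<theta> g))\<^sup>2 \<le> 1 / (1 - \<epsilon>) * M * R f g"
      by blast
    have "(INF a\<in>{a. cmod a = 1}. (norm (f - scaleC a g))\<^sup>2) \<le> (norm (f - scaleC \<theta> g))\<^sup>2"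
      using \<theta>(1) by (intro cINF_lower bdd_belowI2[of _ 0]) auto
    with \<theta>(2) show ?thesis
      by linarith
  qed
  then show ?thesis
    using frame unfolding R_def M_def \<Phi>_def by blast
qed

end
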